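(* Let $E\in\mathcal I$ be a small cut cell. Assume that the set of propagation forms $\{p_{ij}^E\}_{i\ne j}, p_V^E,p_V^{E,*}$ used in the central stabilization terms $J_h^{0,E}$ and $J_h^{1,E}$ is energy preserving and reflecting. Then for all $u_h\in\mathcal V_h^r$ $$J_h^{0,E}(u_h,u_h)+J_h^{1,E}(u_h,u_h)=0 .$$
   Context: **Equation.** $c>0$ is constant, states are $u=(p,v)^T\in\mathbb R^3$ with $p\in\mathbb R$, $v\in\mathbb R^2$, and $\langle\cdot,\cdot\rangle$ is the Euclidean product on $\mathbb R^3$. $f_k(u)=A_ku$ with $A_1=\begin{pmatrix}0&c&0\\c&0&0\\0&0&0\end{pmatrix}$, $A_2=\begin{pmatrix}0&0&c\\0&0&0\\c&0&0\end{pmatrix}$; for a unit vector $n$, $A_n=n_1A_1+n_2A_2$ and $f_n(u)=A_nu$. Write $f(u)\cdot\nabla w=\sum_{k=1}^2\langle f_k(u),\partial_kw\rangle$. **Mesh.** $\Omega\subset\mathbb R^2$ is a bounded domain contained in a rectangle $\widehat\Omega$ with a Cartesian background mesh $\widehat{\mathcal M}_h$. The cut-cell mesh is $\mathcal M_h=\{E=\widehat E\cap\Omega:\widehat E\in\widehat{\mathcal M}_h\}$ (non-empty cells; regular enough that the divergence theorem holds on each). Interior faces: $\Gamma_h^{\rm i}=\{\gamma=\bar E_1\cap\bar E_2:|\gamma|>0\}$ for distinct cells $E_1,E_2$. Boundary faces: $\Gamma_h^{\rm b}=\{\gamma=\bar E\cap\partial\Omega : |\gamma|>0\}$ (so a cell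 has at most one boundary face). $\Gamma_h^{\rm i}(E),\Gamma_h^{\rm b}(E)$ are the interior/boundary faces contained in $\partial E$, $\Gamma_h(E)$ is their union (which makes up $\partial E$), $\mathbb I(E)=\{1,\dots,K\}$ with $K=|\Gamma_h(E)|$ numbers the faces $\gamma_i$ of $E$; $E_i$ is the neighbor of $E$ across $\gamma_i$ if $\gamma_i$ is interior, and just an index symbol ("ghost cell") if $\gamma_i$ is a boundary face. Each interior face has a fixed left and right cell and unit normal $n$ pointing from left to right; on boundary faces $n$ is the outward normal of $\Omega$. $w_\gamma^L,w_\gamma^R$ are the traces from the two sides and $\llbracket w\rrbracket=w_\gamma^L-w_\gamma^R$. $\mathcal V_h^r=\{v_h\in L^2(\Omega)^3: v_h|_E\in P^r(E)^3\ \forall E\in\mathcal M_h\}$, $P^r$ = polynomials of degree at most $r$. **Mirroring.** $\mathfrak M_n(p,v)=(p,\,v-2(v\cdot n)n)$ on $\mathbb R^3$. For a straight boundary face $\gamma$ with constant normal $n$, and a polynomial vector field $u=(p,v)$, $\mathfrak M_{n}(u)(x)=(p(x),\,v(x)-2(v(x^\perp)\cdot n)n)$, where $x^\perp$ is the orthogonal projection of $x$ onto the line containing $\gamma$. **Small cells.** With $\alpha_E=|E|/|\widehat E|$ and a threshold $\alpha\in(0,1)$, $\mathcal I=\{E\in\mathcal M_h:\alpha_E<\alpha\}$. Assumptions: (i) no $E\in\mathcal I$ has a neighbor $E_i\in\mathcal I$; (ii) a boundary face of $E\in\mathcal I$ has constant normal (is contained in a line); (iii) there is $\rho>0$ with $h_E^2\le\rho|E|$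 for all $E\in\mathcal I$, $h_E$ the diameter. For a time step $\Delta t>0$, $\eta_E=1-\frac{1}{2r+1}\frac{|E|}{\Delta t\,c\,\max_{i\in\mathbb I(E)}|\gamma_i|}$. **Extension operators.** For $w_h\in\mathcal V_h^r$, $\mathcal L_E(w_h)$ is the polynomial vector field on the whole domain extending $w_h|_E$. For a boundary face $\gamma$, $\mathcal L_E^\gamma(w_h)=\mathfrak M_{n_\gamma}(\mathcal L_E(w_h))$. For $E\in\mathcal I$ and $i\ne j\in\mathbb I(E)$: $\mathcal L^{ij}_{E}=\mathcal L_E$; for $k\in\{i,j\}$ with $\gamma_k$ interior $\mathcal L^{ij}_{E_k}=\mathcal L_{E_k}$; if $\gamma_i$ is a boundary face, $\mathcal L^{ij}_{E_i}=\mathcal L^{\gamma_i}_{E_j}$; if $\gamma_j$ is a boundary face, $\mathcal L^{ij}_{E_j}=\mathcal L^{\gamma_j}_{E_i}$. **Propagation forms.** For $E\in\mathcal I$ and a face $\gamma$ of $E$ let $b_\gamma(u^\mu,u^\nu,w)=\int_\gamma\langle\tfrac12[f_n(u^\mu)+f_n(u^\nu)],w\rangle$ with $n$ the outward normal of $E$. A set of propagation forms on $E$ consists of maps $p_{ij}^E$ ($i\neq j\in\mathbb I(E)$), $p_V^E$, $p_V^{E,*}$ from $(P^r(E)^3)^3$ to $\mathbb R$, symmetric in the first two arguments, linear in the third, such that for all arguments $p_{ij}^E(u^\mu,u^\nu,w)+p_{ji}^E(u^\mu,u^\nu,w)=p_V^E(u^\mu,u^\nu,w)+p_V^{E,*}(u^\mu,u^\nu,w)$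 for $i\ne j$, and $\sum_{i\neq j}p_{ij}^E(u^\mu,u^\nu,w)=b_{\gamma_j}(u^\mu,u^\nu,w)$ for every $j$. It is *energy preserving* if for all $i\neq j$ and all $w,u^\mu,u^\nu\in P^r(E)^3$: (1) $\frac{2}{K(K-1)}\int_E f(w)\cdot\nabla w=\tfrac12p_{ij}^E(w,w,w)+\tfrac12p_{ji}^E(w,w,w)$; (2) $p_{ij}^E(u^\mu,u^\nu,u^\mu-u^\nu)=\tfrac12p_{ij}^E(u^\mu,u^\mu,u^\mu)-\tfrac12p_{ij}^E(u^\nu,u^\nu,u^\nu)$. It is *reflecting* if, whenever $\gamma_i$ is a boundary face of $E$, with $\mathfrak M=\mathfrak M_{n_{\gamma_i}}$, for all $j\neq i$ and all $u^\mu,u^\nu,w\in P^r(E)^3$: $p_{ji}^E(u^\mu,\mathfrak M(u^\nu),w)=-p_{ji}^E(\mathfrak M(u^\mu),u^\nu,\mathfrak M(w))$. **Central stabilization terms** (sums over pairs $i<j$ in $\mathbb I(E)$): $$J_h^{0,E}(u,w)=\eta_E\sum_{i<j}J_{h,ij}^{0,E}(u,w)-\eta_E\sum_{\gamma\in\Gamma_h^{\rm i}(E)}\int_\gamma\langle\tfrac12[f_n(u_\gamma^L)+f_n(u_\gamma^R)],\llbracket w\rrbracket\rangle-\eta_E\sum_{\gamma\in\Gamma_h^{\rm b}(E)}\int_\gamma\langle\tfrac12[f_n(u)+f_n(\mathfrak M_n(u))],w\rangle,$$ $$J_h^{1,E}(u,w)=\eta_E\sum_{i<j}J_{h,ij}^{1,E}(u,w).$$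 If $\gamma_i,\gamma_j$ are interior: $J_{h,ij}^{0,E}(u,w)=p_{ij}^E(\mathcal L_{E_i}u,\mathcal L_{E_j}u,\mathcal L_Ew-\mathcal L_{E_j}w)+p_{ji}^E(\mathcal L_{E_i}u,\mathcal L_{E_j}u,\mathcal L_Ew-\mathcal L_{E_i}w)$. If one of the two faces is a boundary face, call it $\gamma_i$ (exchanging the roles of $i,j$ if needed): $J_{h,ij}^{0,E}(u,w)=p_{ij}^E(\mathcal L_{E_j}^{\gamma_i}u,\mathcal L_{E_j}u,\mathcal L_Ew-\mathcal L_{E_j}w)+p_{ji}^E(\mathcal L_{E_j}^{\gamma_i}u,\mathcal L_{E_j}u,\mathcal L_Ew)$. With $\omega_E=-1$ and $\omega_{E_i}=\omega_{E_j}=\tfrac12$, $$J_{h,ij}^{1,E}(u,w)=\sum_{\mathcal E\in\{E,E_i,E_j\}}\omega_{\mathcal E}\Big[p_V^E(\mathcal L_{E_i}^{ij}u,\mathcal L_{E_j}^{ij}u,\mathcal L_{\mathcal E}^{ij}w)-\tfrac{2}{K(K-1)}\int_Ef(\mathcal L_{\mathcal E}^{ij}u)\cdot\nabla\mathcal L_{\mathcal E}^{ij}w+p_V^{E,*}(\mathcal L_{E_i}^{ij}w,\mathcal L_{E_j}^{ij}w,\mathcal L_{\mathcal E}^{ij}u)\Big].$$ *)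

theory Defs
  imports "HOL-Analysis.Analysis"
begin

definition hausdorff1_outer :: "'a::metric_space set \<Rightarrow> ennreal" where
  "hausdorff1_outer S =
     (SUP \<delta>\<in>{0<..}. INF A\<in>{A :: nat \<Rightarrow> 'a set. S \<subseteq> (\<Union>k. A k) \<and>
                                (\<forall>k. bounded (A k) \<and> diameter (A k) \<le> \<delta>)}.
        (\<Sum>k. ennreal (diameter (A k))))"

text \<open>The outer measure is metric, hence countably additive on the Borel sets, so the next
  definition yields a measure that agrees with it on Borel sets. It is the length \<open>|\<gamma>|\<close>
  and the line element of all face integrals below.\<close>

definition hausdorff1 :: "'a::metric_space measure" where
  "hausdorff1 = measure_of UNIV (sets borel) hausdorff1_outer"

type_synonym field = "real^2 \<Rightarrow> real^3"

definition pressure :: "real^3 \<Rightarrow> real" where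
  "pressure u = u $ 1"

definition velocity :: "real^3 \<Rightarrow> real^2" where
  "velocity u = vector [u $ 2, u $ 3]"

definition state :: "real \<Rightarrow> real^2 \<Rightarrow> real^3" where
  "state p v = vector [p, v $ 1, v $ 2]"

definition flux_mat :: "real \<Rightarrow> 2 \<Rightarrow> real^3^3" where
  "flux_mat c k =
     (if k = 1 then vector [vector [0, c, 0], vector [c, 0, 0], vector [0, 0, 0]]
      else vector [vector [0, 0, c], vector [0, 0, 0], vector [c, 0, 0]])"

definition normal_mat :: "real \<Rightarrow> real^2 \<Rightarrow> real^3^3" where
  "normal_mat c n = (\<Sum>k\<in>UNIV. n $ k *\<^sub>R flux_mat c k)"

definition flux :: "real \<Rightarrow> 2 \<Rightarrow> real^3 \<Rightarrow> real^3" where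
  "flux c k u = flux_mat c k *v u"

definition normal_flux :: "real \<Rightarrow> real^2 \<Rightarrow> real^3 \<Rightarrow> real^3" where
  "normal_flux c n u = normal_mat c n *v u"

definition partial_deriv :: "2 \<Rightarrow> (real^2 \<Rightarrow> 'b::real_normed_vector) \<Rightarrow> real^2 \<Rightarrow> 'b" where
  "partial_deriv k w x = frechet_derivative w (at x) (axis k 1)"

definition flux_dot_grad :: "real \<Rightarrow> field \<Rightarrow> field \<Rightarrow> real^2 \<Rightarrow> real" where
  "flux_dot_grad c u w x = (\<Sum>k\<in>UNIV. flux c k (u x) \<bullet> partial_deriv k w x)"

definition poly_scalar :: "nat \<Rightarrow> (real^2 \<Rightarrow> real) set" where
  "poly_scalar r = {q. \<exists>a :: nat \<Rightarrow> nat \<Rightarrow> real.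
     \<forall>x. q x = (\<Sum>i\<le>r. \<Sum>j\<le>r - i. a i j * (x $ 1) ^ i * (x $ 2) ^ j)}"

text \<open>Every cell is a non-empty open set, so a polynomial on a cell is identified with the
  unique polynomial on the whole plane extending it.\<close>

definition poly_fields :: "nat \<Rightarrow> field set" where
  "poly_fields r = {q. \<forall>m. (\<lambda>x. q x $ m) \<in> poly_scalar r}"

text \<open>Near \<open>x\<close> the set fills every closed cone around \<open>-n\<close> strictly inside a half plane and misses
  every such cone around \<open>n\<close>.\<close>

definition outer_normal :: "(real^2) set \<Rightarrow> real^2 \<Rightarrow> real^2 \<Rightarrow> bool" where
  "outer_normal S x n \<longleftrightarrow> norm n = 1 \<and>
     (\<forall>\<epsilon>>0. \<exists>\<delta>>0. \<forall>y. 0 < dist y x \<and> dist y x < \<delta> \<longrightarrow>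
        ((y - x) \<bullet> n \<le> - \<epsilon> * dist y x \<longrightarrow> y \<in> S) \<and>
        ((y - x) \<bullet> n \<ge> \<epsilon> * dist y x \<longrightarrow> y \<notin> S))"

text \<open>The background mesh is the tensor grid with nodes \<open>xgrid 0 < \<dots> < xgrid nx\<close> and
  \<open>ygrid 0 < \<dots> < ygrid ny\<close>. The field \<open>normal\<close> gives the unit normal at the points of a face
  and \<open>face E\<close> numbers the faces of \<open>E\<close> from 1.\<close>

record cut_mesh =
  Omega :: "(real^2) set"
  xgrid :: "nat \<Rightarrow> real"
  nx :: nat
  ygrid :: "nat \<Rightarrow> real"
  ny :: nat
  left_cell :: "(real^2) set \<Rightarrow> (real^2) set"
  right_cell :: "(real^2) set \<Rightarrow> (real^2) set"
  normal :: "(real^2) set \<Rightarrow> real^2 \<Rightarrow> real^2"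
  face :: "(real^2) set \<Rightarrow> nat \<Rightarrow> (real^2) set"

definition background_domain :: "cut_mesh \<Rightarrow> (real^2) set" where
  "background_domain T =
     cbox (vector [xgrid T 0, ygrid T 0]) (vector [xgrid T (nx T), ygrid T (ny T)])"

definition background_cells :: "cut_mesh \<Rightarrow> (real^2) set set" where
  "background_cells T =
     {box (vector [xgrid T i, ygrid T j]) (vector [xgrid T (Suc i), ygrid T (Suc j)]) | i j.
        i < nx T \<and> j < ny T}"

definition cells :: "cut_mesh \<Rightarrow> (real^2) set set" where
  "cells T = {B \<inter> Omega T | B. B \<in> background_cells T \<and> B \<inter> Omega T \<noteq> {}}"

definition background_cell :: "cut_mesh \<Rightarrow> (real^2) set \<Rightarrow> (real^2) set" where
  "background_cell T E = (THE B. B \<in> background_cells T \<and> E = B \<inter> Omega T)"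

definition interior_faces :: "cut_mesh \<Rightarrow> (real^2) set set" where
  "interior_faces T = {closure E1 \<inter> closure E2 | E1 E2.
     E1 \<in> cells T \<and> E2 \<in> cells T \<and> E1 \<noteq> E2 \<and> emeasure hausdorff1 (closure E1 \<inter> closure E2) > 0}"

definition boundary_faces :: "cut_mesh \<Rightarrow> (real^2) set set" where
  "boundary_faces T = {closure E \<inter> frontier (Omega T) | E.
     E \<in> cells T \<and> emeasure hausdorff1 (closure E \<inter> frontier (Omega T)) > 0}"

definition interior_faces_of :: "cut_mesh \<Rightarrow> (real^2) set \<Rightarrow> (real^2) set set" where
  "interior_faces_of T E = {\<gamma> \<in> interior_faces T. \<gamma> \<subseteq> frontier E}"

definition boundary_faces_of :: "cut_mesh \<Rightarrow> (real^2) set \<Rightarrow> (real^2) set set" where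
  "boundary_faces_of T E = {\<gamma> \<in> boundary_faces T. \<gamma> \<subseteq> frontier E}"

definition faces_of :: "cut_mesh \<Rightarrow> (real^2) set \<Rightarrow> (real^2) set set" where
  "faces_of T E = interior_faces_of T E \<union> boundary_faces_of T E"

definition num_faces :: "cut_mesh \<Rightarrow> (real^2) set \<Rightarrow> nat" where
  "num_faces T E = card (faces_of T E)"

definition face_indices :: "cut_mesh \<Rightarrow> (real^2) set \<Rightarrow> nat set" where
  "face_indices T E = {1..num_faces T E}"

definition index_pairs :: "cut_mesh \<Rightarrow> (real^2) set \<Rightarrow> (nat \<times> nat) set" where
  "index_pairs T E = {(i, j). i \<in> face_indices T E \<and> j \<in> face_indices T E \<and> i < j}"

definition cell_normal :: "cut_mesh \<Rightarrow> (real^2) set \<Rightarrow> (real^2) set \<Rightarrow> real^2 \<Rightarrow> real^2" where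
  "cell_normal T E \<gamma> x =
     (if \<gamma> \<in> interior_faces T \<and> right_cell T \<gamma> = E then - normal T \<gamma> x else normal T \<gamma> x)"

definition neighbor :: "cut_mesh \<Rightarrow> (real^2) set \<Rightarrow> (real^2) set \<Rightarrow> (real^2) set" where
  "neighbor T E \<gamma> = (if left_cell T \<gamma> = E then right_cell T \<gamma> else left_cell T \<gamma>)"

definition divergence_theorem_on :: "cut_mesh \<Rightarrow> (real^2) set \<Rightarrow> bool" where
  "divergence_theorem_on T E \<longleftrightarrow>
     (\<forall>F :: real^2 \<Rightarrow> real^2.
        (\<forall>x. F differentiable (at x)) \<and> (\<forall>k. continuous_on UNIV (partial_deriv k F)) \<longrightarrow>
        (LINT x:E|lborel. (\<Sum>k\<in>UNIV. partial_deriv k F x $ k)) =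
        (\<Sum>\<gamma>\<in>faces_of T E. LINT x:\<gamma>|hausdorff1. F x \<bullet> cell_normal T E \<gamma> x))"

text \<open>The condition that interior faces meet the boundary of the domain in a set of length zero
  excludes slits along mesh lines; it makes every face either interior or boundary and
  leaves each cell with at most one boundary face.\<close>

definition cut_cell_mesh :: "cut_mesh \<Rightarrow> bool" where
  "cut_cell_mesh T \<longleftrightarrow>
     strict_mono_on {..nx T} (xgrid T) \<and> strict_mono_on {..ny T} (ygrid T) \<and>
     open (Omega T) \<and> connected (Omega T) \<and> Omega T \<noteq> {} \<and> bounded (Omega T) \<and>
     Omega T \<subseteq> background_domain T \<and>
     (\<forall>\<gamma>\<in>interior_faces T. emeasure hausdorff1 (\<gamma> \<inter> frontier (Omega T)) = 0) \<and>
     (\<forall>\<gamma>\<in>interior_faces T.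
        left_cell T \<gamma> \<in> cells T \<and> right_cell T \<gamma> \<in> cells T \<and> left_cell T \<gamma> \<noteq> right_cell T \<gamma> \<and>
        \<gamma> = closure (left_cell T \<gamma>) \<inter> closure (right_cell T \<gamma>) \<and>
        (\<forall>x\<in>\<gamma>. norm (normal T \<gamma> x) = 1 \<and>
           (\<forall>y\<in>\<gamma>. \<forall>z\<in>\<gamma>. (z - y) \<bullet> normal T \<gamma> x = 0) \<and>
           (\<forall>y\<in>left_cell T \<gamma>. \<forall>z\<in>right_cell T \<gamma>. (z - y) \<bullet> normal T \<gamma> x > 0))) \<and>
     (\<forall>\<gamma>\<in>boundary_faces T. AE x in hausdorff1. x \<in> \<gamma> \<longrightarrow> outer_normal (Omega T) x (normal T \<gamma> x)) \<and>
     (\<forall>E\<in>cells T.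
        bij_betw (face T E) (face_indices T E) (faces_of T E) \<and>
        emeasure hausdorff1 (frontier E - \<Union>(faces_of T E)) = 0 \<and>
        divergence_theorem_on T E)"

definition small_cells :: "cut_mesh \<Rightarrow> real \<Rightarrow> (real^2) set set" where
  "small_cells T \<alpha> =
     {E \<in> cells T. measure lborel E / measure lborel (background_cell T E) < \<alpha>}"

definition straight_face :: "cut_mesh \<Rightarrow> (real^2) set \<Rightarrow> bool" where
  "straight_face T \<gamma> \<longleftrightarrow>
     (\<exists>n. (\<forall>x\<in>\<gamma>. normal T \<gamma> x = n) \<and> (\<forall>x\<in>\<gamma>. \<forall>y\<in>\<gamma>. (y - x) \<bullet> n = 0))"

definition small_cell_assumptions :: "cut_mesh \<Rightarrow> real \<Rightarrow> bool" where
  "small_cell_assumptions T \<alpha> \<longleftrightarrow>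
     (\<forall>E\<in>small_cells T \<alpha>. \<forall>\<gamma>\<in>interior_faces_of T E. neighbor T E \<gamma> \<notin> small_cells T \<alpha>) \<and>
     (\<forall>E\<in>small_cells T \<alpha>. \<forall>\<gamma>\<in>boundary_faces_of T E. straight_face T \<gamma>) \<and>
     (\<exists>\<rho>>0. \<forall>E\<in>small_cells T \<alpha>. (diameter E)\<^sup>2 \<le> \<rho> * measure lborel E)"

definition eta :: "cut_mesh \<Rightarrow> real \<Rightarrow> nat \<Rightarrow> real \<Rightarrow> (real^2) set \<Rightarrow> real" where
  "eta T c r \<Delta>t E =
     1 - 1 / (2 * real r + 1) *
         (measure lborel E /
          (\<Delta>t * c * Max ((\<lambda>i. measure hausdorff1 (face T E i)) ` face_indices T E)))"

definition V_h :: "cut_mesh \<Rightarrow> nat \<Rightarrow> field set" where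
  "V_h T r = {v. v \<in> borel_measurable (lebesgue_on (Omega T)) \<and>
      integrable (lebesgue_on (Omega T)) (\<lambda>x. (norm (v x))\<^sup>2) \<and>
      (\<forall>E\<in>cells T. \<exists>q\<in>poly_fields r. \<forall>x\<in>E. v x = q x)}"

definition trace_from :: "(real^2) set \<Rightarrow> field \<Rightarrow> field" where
  "trace_from E w x = Lim (at x within E) w"

definition mirror :: "real^2 \<Rightarrow> real^3 \<Rightarrow> real^3" where
  "mirror n u = state (pressure u) (velocity u - (2 * (velocity u \<bullet> n)) *\<^sub>R n)"

definition face_normal :: "cut_mesh \<Rightarrow> (real^2) set \<Rightarrow> real^2" where
  "face_normal T \<gamma> = (THE n. \<forall>x\<in>\<gamma>. normal T \<gamma> x = n)"

text \<open>A straight face has positive length, so its affine hull is the line containing it, and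
  the closest point of that line is the orthogonal projection onto it.\<close>

definition mirror_field :: "cut_mesh \<Rightarrow> (real^2) set \<Rightarrow> field \<Rightarrow> field" where
  "mirror_field T \<gamma> u x =
     (let n = face_normal T \<gamma>; x' = closest_point (affine hull \<gamma>) x
      in state (pressure (u x)) (velocity (u x) - (2 * (velocity (u x') \<bullet> n)) *\<^sub>R n))"

definition ext_cell :: "nat \<Rightarrow> (real^2) set \<Rightarrow> field \<Rightarrow> field" where
  "ext_cell r E w = (SOME q. q \<in> poly_fields r \<and> (\<forall>x\<in>E. q x = w x))"

definition ext_mirror :: "cut_mesh \<Rightarrow> nat \<Rightarrow> (real^2) set \<Rightarrow> (real^2) set \<Rightarrow> field \<Rightarrow> field" where
  "ext_mirror T r \<gamma> E w = mirror_field T \<gamma> (ext_cell r E w)"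

definition nbr_cell :: "cut_mesh \<Rightarrow> (real^2) set \<Rightarrow> nat \<Rightarrow> (real^2) set" where
  "nbr_cell T E i = neighbor T E (face T E i)"

text \<open>\<open>ext_pair T r E i j\<close> is the extension operator attached to \<open>E\<^sub>i\<close> for the pair \<open>{i, j}\<close>; the
  one attached to \<open>E\<^sub>j\<close> is \<open>ext_pair T r E j i\<close>.\<close>

definition ext_pair :: "cut_mesh \<Rightarrow> nat \<Rightarrow> (real^2) set \<Rightarrow> nat \<Rightarrow> nat \<Rightarrow> field \<Rightarrow> field" where
  "ext_pair T r E i j w =
     (if face T E i \<in> boundary_faces T then ext_mirror T r (face T E i) (nbr_cell T E j) w
      else ext_cell r (nbr_cell T E i) w)"

type_synonym form = "field \<Rightarrow> field \<Rightarrow> field \<Rightarrow> real"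

definition b_face :: "cut_mesh \<Rightarrow> real \<Rightarrow> (real^2) set \<Rightarrow> (real^2) set \<Rightarrow> form" where
  "b_face T c E \<gamma> u1 u2 w =
     (LINT x:\<gamma>|hausdorff1.
        ((1 / 2) *\<^sub>R (normal_flux c (cell_normal T E \<gamma> x) (u1 x) +
                     normal_flux c (cell_normal T E \<gamma> x) (u2 x))) \<bullet> w x)"

definition sym_lin_form :: "nat \<Rightarrow> form \<Rightarrow> bool" where
  "sym_lin_form r q \<longleftrightarrow>
     (\<forall>u1\<in>poly_fields r. \<forall>u2\<in>poly_fields r. \<forall>w\<in>poly_fields r.
        q u1 u2 w = q u2 u1 w \<and>
        (\<forall>z\<in>poly_fields r. q u1 u2 (\<lambda>x. w x + z x) = q u1 u2 w + q u1 u2 z) \<and>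
        (\<forall>a. q u1 u2 (\<lambda>x. a *\<^sub>R w x) = a * q u1 u2 w))"

definition propagation_forms ::
  "cut_mesh \<Rightarrow> real \<Rightarrow> nat \<Rightarrow> (real^2) set \<Rightarrow> (nat \<Rightarrow> nat \<Rightarrow> form) \<Rightarrow> form \<Rightarrow> form \<Rightarrow> bool" where
  "propagation_forms T c r E p pV pV' \<longleftrightarrow>
     (\<forall>i\<in>face_indices T E. \<forall>j\<in>face_indices T E. i \<noteq> j \<longrightarrow> sym_lin_form r (p i j)) \<and>
     sym_lin_form r pV \<and> sym_lin_form r pV' \<and>
     (\<forall>u1\<in>poly_fields r. \<forall>u2\<in>poly_fields r. \<forall>w\<in>poly_fields r.
        (\<forall>i\<in>face_indices T E. \<forall>j\<in>face_indices T E. i \<noteq> j \<longrightarrow>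
           p i j u1 u2 w + p j i u1 u2 w = pV u1 u2 w + pV' u1 u2 w) \<and>
        (\<forall>j\<in>face_indices T E.
           (\<Sum>i\<in>face_indices T E - {j}. p i j u1 u2 w) = b_face T c E (face T E j) u1 u2 w))"

definition energy_preserving ::
  "cut_mesh \<Rightarrow> real \<Rightarrow> nat \<Rightarrow> (real^2) set \<Rightarrow> (nat \<Rightarrow> nat \<Rightarrow> form) \<Rightarrow> bool" where
  "energy_preserving T c r E p \<longleftrightarrow>
     (\<forall>i\<in>face_indices T E. \<forall>j\<in>face_indices T E. i \<noteq> j \<longrightarrow>
        (\<forall>w\<in>poly_fields r.
           2 / (real (num_faces T E) * (real (num_faces T E) - 1)) *
             (LINT x:E|lborel. flux_dot_grad c w w x) =
           1 / 2 * p i j w w w + 1 / 2 * p j i w w w) \<and>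
        (\<forall>u1\<in>poly_fields r. \<forall>u2\<in>poly_fields r.
           p i j u1 u2 (\<lambda>x. u1 x - u2 x) = 1 / 2 * p i j u1 u1 u1 - 1 / 2 * p i j u2 u2 u2))"

definition reflecting ::
  "cut_mesh \<Rightarrow> nat \<Rightarrow> (real^2) set \<Rightarrow> (nat \<Rightarrow> nat \<Rightarrow> form) \<Rightarrow> bool" where
  "reflecting T r E p \<longleftrightarrow>
     (\<forall>i\<in>face_indices T E. face T E i \<in> boundary_faces_of T E \<longrightarrow>
        (\<forall>j\<in>face_indices T E. j \<noteq> i \<longrightarrow>
           (\<forall>u1\<in>poly_fields r. \<forall>u2\<in>poly_fields r. \<forall>w\<in>poly_fields r.
              p j i u1 (mirror_field T (face T E i) u2) w =
              - p j i (mirror_field T (face T E i) u1) u2 (mirror_field T (face T E i) w))))"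

definition J0_interior_pair ::
  "cut_mesh \<Rightarrow> nat \<Rightarrow> (real^2) set \<Rightarrow> (nat \<Rightarrow> nat \<Rightarrow> form) \<Rightarrow> nat \<Rightarrow> nat \<Rightarrow> field \<Rightarrow> field \<Rightarrow> real" where
  "J0_interior_pair T r E p i j u w =
     (let ui = ext_cell r (nbr_cell T E i) u; uj = ext_cell r (nbr_cell T E j) u
      in p i j ui uj (\<lambda>x. ext_cell r E w x - ext_cell r (nbr_cell T E j) w x) +
         p j i ui uj (\<lambda>x. ext_cell r E w x - ext_cell r (nbr_cell T E i) w x))"

definition J0_boundary_pair ::
  "cut_mesh \<Rightarrow> nat \<Rightarrow> (real^2) set \<Rightarrow> (nat \<Rightarrow> nat \<Rightarrow> form) \<Rightarrow> nat \<Rightarrow> nat \<Rightarrow> field \<Rightarrow> field \<Rightarrow> real" where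
  "J0_boundary_pair T r E p i j u w =
     (let ui = ext_mirror T r (face T E i) (nbr_cell T E j) u; uj = ext_cell r (nbr_cell T E j) u
      in p i j ui uj (\<lambda>x. ext_cell r E w x - ext_cell r (nbr_cell T E j) w x) +
         p j i ui uj (ext_cell r E w))"

definition J0_pair ::
  "cut_mesh \<Rightarrow> nat \<Rightarrow> (real^2) set \<Rightarrow> (nat \<Rightarrow> nat \<Rightarrow> form) \<Rightarrow> nat \<Rightarrow> nat \<Rightarrow> field \<Rightarrow> field \<Rightarrow> real" where
  "J0_pair T r E p i j u w =
     (if face T E i \<in> boundary_faces T then J0_boundary_pair T r E p i j u w
      else if face T E j \<in> boundary_faces T then J0_boundary_pair T r E p j i u w
      else J0_interior_pair T r E p i j u w)"

definition J0 ::
  "cut_mesh \<Rightarrow> real \<Rightarrow> nat \<Rightarrow> real \<Rightarrow> (real^2) set \<Rightarrow> (nat \<Rightarrow> nat \<Rightarrow> form) \<Rightarrow> field \<Rightarrow> field \<Rightarrow> real" where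
  "J0 T c r \<Delta>t E p u w =
     eta T c r \<Delta>t E * (\<Sum>(i, j)\<in>index_pairs T E. J0_pair T r E p i j u w)
     - eta T c r \<Delta>t E * (\<Sum>\<gamma>\<in>interior_faces_of T E.
         LINT x:\<gamma>|hausdorff1.
           ((1 / 2) *\<^sub>R (normal_flux c (normal T \<gamma> x) (trace_from (left_cell T \<gamma>) u x) +
                        normal_flux c (normal T \<gamma> x) (trace_from (right_cell T \<gamma>) u x))) \<bullet>
           (trace_from (left_cell T \<gamma>) w x - trace_from (right_cell T \<gamma>) w x))
     - eta T c r \<Delta>t E * (\<Sum>\<gamma>\<in>boundary_faces_of T E.
         LINT x:\<gamma>|hausdorff1.
           ((1 / 2) *\<^sub>R (normal_flux c (normal T \<gamma> x) (trace_from E u x) +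
                        normal_flux c (normal T \<gamma> x) (mirror (normal T \<gamma> x) (trace_from E u x)))) \<bullet>
           trace_from E w x)"

definition J1_pair ::
  "cut_mesh \<Rightarrow> real \<Rightarrow> nat \<Rightarrow> (real^2) set \<Rightarrow> form \<Rightarrow> form \<Rightarrow> nat \<Rightarrow> nat \<Rightarrow> field \<Rightarrow> field \<Rightarrow> real" where
  "J1_pair T c r E pV pV' i j u w =
     (\<Sum>(\<omega>, ext) \<leftarrow> [(- 1, ext_cell r E), (1 / 2, ext_pair T r E i j), (1 / 2, ext_pair T r E j i)].
        \<omega> * (pV (ext_pair T r E i j u) (ext_pair T r E j i u) (ext w)
             - 2 / (real (num_faces T E) * (real (num_faces T E) - 1)) *
                 (LINT x:E|lborel. flux_dot_grad c (ext u) (ext w) x)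
             + pV' (ext_pair T r E i j w) (ext_pair T r E j i w) (ext u)))"

definition J1 ::
  "cut_mesh \<Rightarrow> real \<Rightarrow> nat \<Rightarrow> real \<Rightarrow> (real^2) set \<Rightarrow> form \<Rightarrow> form \<Rightarrow> field \<Rightarrow> field \<Rightarrow> real" where
  "J1 T c r \<Delta>t E pV pV' u w =
     eta T c r \<Delta>t E * (\<Sum>(i, j)\<in>index_pairs T E. J1_pair T c r E pV pV' i j u w)"

end

theory Submission
  imports Defs
begin

text \<open>Inserting \<open>w = u\<close> into the stabilization terms of a pair \<open>i < j\<close> and using energy preservation,
  everything cancels except \<open>net i j + net j i\<close>, where \<open>net i j\<close> is
  \<open>1/2 p\<^sub>i\<^sub>j(e, e, e) - 1/2 p\<^sub>i\<^sub>j(u\<^sub>j, u\<^sub>j, u\<^sub>j)\<close>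
  for the extensions \<open>e\<close> from \<open>E\<close> and \<open>u\<^sub>j\<close> from \<open>E\<^sub>j\<close>, and the
  second term is absent for a boundary face \<open>\<gamma>\<^sub>j\<close>: there the reflection property, applied twice to
  the involution given by mirroring, makes the contributions of the ghost cell vanish. Summation
  over \<open>i\<close> turns the propagation forms into face integrals \<open>b\<^sub>\<gamma>\<close>. As the flux matrices are symmetric, these are
  exactly the integrals of average times jump on interior faces, while on boundary faces the
  mirrored flux has no energy contribution. Face integrals may be split because interior faces are
  compact pieces of lines, hence of finite length.\<close>

section \<open>Polynomial fields and mirroring\<close>

lemma monomial_poly_scalar:
  assumes "i + j \<le> r"
  shows "(\<lambda>x. (x $ 1) ^ i * (x $ 2) ^ j) \<in> poly_scalar r"
proof -
  define a :: "nat \<Rightarrow> nat \<Rightarrow> real" where "a k l = (if k = i then (if l = j then 1 else 0) else 0)" for k l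
  have "(x $ 1) ^ i * (x $ 2) ^ j = (\<Sum>k\<le>r. \<Sum>l\<le>r - k. a k l * (x $ 1) ^ k * (x $ 2) ^ l)"
    for x :: "real^2"
  proof -
    have "(\<Sum>l\<le>r - k. a k l * (x $ 1) ^ k * (x $ 2) ^ l) =
        (if k = i then (x $ 1) ^ i * (x $ 2) ^ j else 0)" for k
      using assms by (auto simp add: a_def if_distrib[of "\<lambda>c. c * _"] cong: if_cong)
    then show ?thesis
      using assms by simp
  qed
  then show ?thesis
    unfolding poly_scalar_def by blast
qed

lemma poly_scalar_add:
  assumes "p \<in> poly_scalar r" "q \<in> poly_scalar r"
  shows "(\<lambda>x. p x + q x) \<in> poly_scalar r"
proof -
  obtain a b where
    "\<And>x. p x = (\<Sum>i\<le>r. \<Sum>j\<le>r - i. a i j * (x $ 1) ^ i * (x $ 2) ^ j)"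
    "\<And>x. q x = (\<Sum>i\<le>r. \<Sum>j\<le>r - i. b i j * (x $ 1) ^ i * (x $ 2) ^ j)"
    using assms unfolding poly_scalar_def by blast
  then have "\<forall>x. p x + q x = (\<Sum>i\<le>r. \<Sum>j\<le>r - i. (a i j + b i j) * (x $ 1) ^ i * (x $ 2) ^ j)"
    by (simp add: sum.distrib algebra_simps)
  then show ?thesis
    unfolding poly_scalar_def by (intro CollectI exI[of _ "\<lambda>i j. a i j + b i j"])
qed

lemma poly_scalar_scale:
  assumes "p \<in> poly_scalar r"
  shows "(\<lambda>x. c * p x) \<in> poly_scalar r"
proof -
  obtain a where "\<And>x. p x = (\<Sum>i\<le>r. \<Sum>j\<le>r - i. a i j * (x $ 1) ^ i * (x $ 2) ^ j)"
    using assms unfolding poly_scalar_def by blast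
  then have "\<forall>x. c * p x = (\<Sum>i\<le>r. \<Sum>j\<le>r - i. (c * a i j) * (x $ 1) ^ i * (x $ 2) ^ j)"
    by (simp add: sum_distrib_left algebra_simps)
  then show ?thesis
    unfolding poly_scalar_def by (intro CollectI exI[of _ "\<lambda>i j. c * a i j"])
qed

lemma poly_scalar_sum:
  assumes "\<And>k. k \<in> K \<Longrightarrow> p k \<in> poly_scalar r"
  shows "(\<lambda>x. \<Sum>k\<in>K. p k x) \<in> poly_scalar r"
proof -
  have "(\<lambda>x. 0) \<in> poly_scalar r"
    using poly_scalar_scale[OF monomial_poly_scalar[of 0 0 r], of 0] by simp
  then show ?thesis
    using assms by (induction K rule: infinite_finite_induct) (auto intro: poly_scalar_add)
qed

text \<open>Each summand is bracketed as a scalar times a monomial, so that closure properties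
  reduce to \<open>poly_scalar_sum\<close>, \<open>poly_scalar_scale\<close> and
  \<open>monomial_poly_scalar\<close>.\<close>

lemma poly_scalarE:
  assumes "q \<in> poly_scalar r"
  obtains a where "q = (\<lambda>x. \<Sum>i\<le>r. \<Sum>j\<le>r - i. a i j * ((x $ 1) ^ i * (x $ 2) ^ j))"
proof -
  obtain a where "\<forall>x. q x = (\<Sum>i\<le>r. \<Sum>j\<le>r - i. a i j * (x $ 1) ^ i * (x $ 2) ^ j)"
    using assms unfolding poly_scalar_def by blast
  then show thesis
    by (intro that[of a] ext) (simp add: mult.assoc)
qed

lemma poly_scalar_mono:
  assumes "q \<in> poly_scalar r" "r \<le> s"
  shows "q \<in> poly_scalar s"
  using assms(1)
proof (rule poly_scalarE)
  fix a assume "q = (\<lambda>x. \<Sum>i\<le>r. \<Sum>j\<le>r - i. a i j * ((x $ 1) ^ i * (x $ 2) ^ j))"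
  then show ?thesis
    using assms(2) by (auto intro!: poly_scalar_sum poly_scalar_scale monomial_poly_scalar)
qed

text \<open>An affine factor either keeps a monomial or raises one of its exponents by one. This is
  the induction step for products of powers of affine functions.\<close>

lemma poly_scalar_affine_mult:
  assumes "q \<in> poly_scalar r"
  shows "(\<lambda>x. (A + B * x $ 1 + C * x $ 2) * q x) \<in> poly_scalar (Suc r)"
  using assms
proof (rule poly_scalarE)
  fix a assume "q = (\<lambda>x. \<Sum>i\<le>r. \<Sum>j\<le>r - i. a i j * ((x $ 1) ^ i * (x $ 2) ^ j))"
  then have "(\<lambda>x. (A + B * x $ 1 + C * x $ 2) * q x) =
      (\<lambda>x. \<Sum>i\<le>r. \<Sum>j\<le>r - i. a i j * (A * ((x $ 1) ^ i * (x $ 2) ^ j)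
        + (B * ((x $ 1) ^ Suc i * (x $ 2) ^ j) + C * ((x $ 1) ^ i * (x $ 2) ^ Suc j))))"
    by (simp add: sum_distrib_left algebra_simps)
  also have "\<dots> \<in> poly_scalar (Suc r)"
    by (intro poly_scalar_sum poly_scalar_scale poly_scalar_add monomial_poly_scalar) auto
  finally show ?thesis .
qed

lemma poly_scalar_affine_powers:
  "(\<lambda>x. (A + B * x $ 1 + C * x $ 2) ^ i * (A' + B' * x $ 1 + C' * x $ 2) ^ j) \<in> poly_scalar (i + j)"
proof (induction i)
  case 0
  show ?case
  proof (induction j)
    case 0
    show ?case using monomial_poly_scalar[of 0 0 0] by simp
  next
    case (Suc j)
    then show ?case using poly_scalar_affine_mult[OF Suc, of A' B' C'] by simp
  qed
next
  case (Suc i)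
  then show ?case using poly_scalar_affine_mult[OF Suc, of A B C] by (simp add: mult.assoc)
qed

text \<open>An affine substitution turns a monomial of degree \<open>i + j\<close> into a product of
  \<open>i + j\<close> affine factors, so the degree does not grow. The orthogonal projection onto a
  line is such a substitution, which keeps mirrored fields in \<open>poly_fields r\<close>.\<close>

lemma poly_scalar_compose_affine:
  assumes "q \<in> poly_scalar r"
    and "\<And>x. g x $ 1 = A + B * x $ 1 + C * x $ 2"
    and "\<And>x. g x $ 2 = A' + B' * x $ 1 + C' * x $ 2"
  shows "(\<lambda>x. q (g x)) \<in> poly_scalar r"
  using assms(1)
proof (rule poly_scalarE)
  fix a assume q: "q = (\<lambda>x. \<Sum>i\<le>r. \<Sum>j\<le>r - i. a i j * ((x $ 1) ^ i * (x $ 2) ^ j))"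
  have "(\<lambda>x. (A + B * x $ 1 + C * x $ 2) ^ i * (A' + B' * x $ 1 + C' * x $ 2) ^ j) \<in> poly_scalar r"
    if "i + j \<le> r" for i j
    using poly_scalar_affine_powers that by (rule poly_scalar_mono)
  then show ?thesis
    unfolding q assms(2,3) by (intro poly_scalar_sum poly_scalar_scale) auto
qed

lemma poly_scalar_continuous: "q \<in> poly_scalar r \<Longrightarrow> continuous_on S q"
  by (erule poly_scalarE, hypsubst) (intro continuous_intros)

lemma poly_fields_continuous: "q \<in> poly_fields r \<Longrightarrow> continuous_on S q"
  unfolding poly_fields_def
  by (subst continuous_on_componentwise) 
    (auto simp: Basis_vec_def inner_axis intro: poly_scalar_continuous)

lemma poly_fields_scale:
  "q \<in> poly_fields r \<Longrightarrow> (\<lambda>x. a *\<^sub>R q x) \<in> poly_fields r"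
  by (simp add: poly_fields_def poly_scalar_scale)

lemma sym_lin_form_commute:
  "\<lbrakk>sym_lin_form r q; u1 \<in> poly_fields r; u2 \<in> poly_fields r; w \<in> poly_fields r\<rbrakk>
    \<Longrightarrow> q u1 u2 w = q u2 u1 w"
  unfolding sym_lin_form_def by blast

lemma sym_lin_form_diff:
  assumes "sym_lin_form r q"
    and "u1 \<in> poly_fields r" "u2 \<in> poly_fields r" "w \<in> poly_fields r" "z \<in> poly_fields r"
  shows "q u1 u2 (\<lambda>x. w x - z x) = q u1 u2 w - q u1 u2 z"
proof -
  note lin = assms(1)[unfolded sym_lin_form_def, rule_format, OF assms(2,3), THEN conjunct2]
  have "q u1 u2 (\<lambda>x. w x + (-1) *\<^sub>R z x) = q u1 u2 w + q u1 u2 (\<lambda>x. (-1) *\<^sub>R z x)"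
    by (rule lin[THEN conjunct1, rule_format, OF assms(4) poly_fields_scale[OF assms(5)]])
  also have "q u1 u2 (\<lambda>x. (-1) *\<^sub>R z x) = (-1) * q u1 u2 z"
    by (rule lin[THEN conjunct2, rule_format, OF assms(5)])
  finally show ?thesis by simp
qed

text \<open>In the plane the vectors orthogonal to \<open>n\<close> form a line, spanned by
  \<open>b - a\<close>. Hence the foot of the perpendicular from \<open>x\<close> lies in the affine
  hull, and it is the nearest point there.\<close>

lemma closest_point_line:
  fixes a b n x :: "real^2"
  assumes "norm n = 1" "a \<in> S" "b \<in> S" "a \<noteq> b" "\<And>y. y \<in> S \<Longrightarrow> (y - a) \<bullet> n = 0"
  shows "closest_point (affine hull S) x = x - ((x - a) \<bullet> n) *\<^sub>R n"
proof -
  let ?y = "x - ((x - a) \<bullet> n) *\<^sub>R n"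
  have nn: "n \<bullet> n = 1"
    using assms(1) by (simp add: norm_eq_1)
  have "affine hull S \<subseteq> {y. n \<bullet> y = n \<bullet> a}"
    using assms(5) by (intro hull_minimal affine_hyperplane) (auto simp: inner_diff_left inner_commute[of n])
  then have orth: "(z - a) \<bullet> n = 0" if "z \<in> affine hull S" for z
    using that by (auto simp: inner_diff_left inner_commute[of n])
  define d where "d = b - a"
  define y where "y = ?y - a"
  have "d \<bullet> n = 0"
    using assms(3,5) by (simp add: d_def)
  moreover have "y \<bullet> n = 0"
    by (simp add: y_def inner_diff_left nn)
  ultimately have dn': "d$1 * n$1 + d$2 * n$2 = 0" and yn': "y$1 * n$1 + y$2 * n$2 = 0"
    and nn': "n$1 * n$1 + n$2 * n$2 = 1"
    using nn by (simp_all add: inner_vec_def sum_2)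
  \<comment> \<open>Both \<open>y\<close> and \<open>d\<close> are orthogonal to the unit vector
    \<open>n\<close>, so they are parallel.\<close>
  have det: "y$1 * d$2 = y$2 * d$1"
    using dn' yn' nn' by algebra
  have "d \<bullet> d \<noteq> 0" using assms(4) by (simp add: d_def)
  have "y = ((y \<bullet> d) / (d \<bullet> d)) *\<^sub>R d"
  proof -
    have "(d \<bullet> d) *\<^sub>R y = (y \<bullet> d) *\<^sub>R d"
    proof -
      have "(d$1 * d$1 + d$2 * d$2) * y$1 = (y$1 * d$1 + y$2 * d$2) * d$1"
        "(d$1 * d$1 + d$2 * d$2) * y$2 = (y$1 * d$1 + y$2 * d$2) * d$2"
        using det by algebra+
      then show ?thesis
        by (simp add: vec_eq_iff forall_2 inner_vec_def sum_2)
    qed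
    then have "(1 / (d \<bullet> d)) *\<^sub>R ((d \<bullet> d) *\<^sub>R y) = (1 / (d \<bullet> d)) *\<^sub>R ((y \<bullet> d) *\<^sub>R d)"
      by simp
    then show ?thesis
      using \<open>d \<bullet> d \<noteq> 0\<close> by simp
  qed
  then obtain t where "y = t *\<^sub>R d" by blast
  then have "?y = (1 - t) *\<^sub>R a + t *\<^sub>R b"
    by (simp add: y_def d_def algebra_simps)
  moreover have "(1 - t) *\<^sub>R a + t *\<^sub>R b \<in> affine hull S"
    using assms(2,3) by (intro mem_affine affine_affine_hull hull_inc) auto
  ultimately have mem: "?y \<in> affine hull S" by simp
  have "dist x ?y \<le> dist x z" if "z \<in> affine hull S" for z
  proof -
    \<comment> \<open>All points of the line have the same normal component, so the distance from
      \<open>x\<close> to any of them is at least the normal offset of \<open>x\<close>, which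
      \<open>?y\<close> attains.\<close>
    have "dist x ?y = \<bar>(x - a) \<bullet> n\<bar>"
      using assms(1) by (simp add: dist_norm)
    also have "\<bar>(x - a) \<bullet> n\<bar> = \<bar>(x - z) \<bullet> n\<bar>"
      using orth[OF that] by (simp add: inner_diff_left)
    also have "\<bar>(x - z) \<bullet> n\<bar> \<le> dist x z"
      using Cauchy_Schwarz_ineq2[of "x - z" n] assms(1) by (simp add: dist_norm)
    finally show ?thesis .
  qed
  then show ?thesis
    using mem by (intro closest_point_unique[symmetric])
      (auto simp: affine_imp_convex affine_affine_hull closed_affine_hull)
qed

section \<open>Fluxes and mirrored states in coordinates\<close>

lemma state_nth [simp]: "state p v $ 1 = p" "state p v $ 2 = v $ 1" "state p v $ 3 = v $ 2"
  by (simp_all add: state_def)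

lemma velocity_nth [simp]: "velocity u $ 1 = u $ 2" "velocity u $ 2 = u $ 3"
  by (simp_all add: velocity_def)

lemma normal_flux_inner:
  "normal_flux c n u \<bullet> w =
     c * (u $ 1 * (n $ 1 * w $ 2 + n $ 2 * w $ 3) + (n $ 1 * u $ 2 + n $ 2 * u $ 3) * w $ 1)"
  by (simp add: normal_flux_def normal_mat_def flux_mat_def inner_vec_def sum_2 sum_3
      matrix_vector_mult_def algebra_simps)

lemma mirror_nth:
  "mirror n u $ 1 = u $ 1"
  "mirror n u $ 2 = u $ 2 - 2 * (u $ 2 * n $ 1 + u $ 3 * n $ 2) * n $ 1"
  "mirror n u $ 3 = u $ 3 - 2 * (u $ 2 * n $ 1 + u $ 3 * n $ 2) * n $ 2"
  by (simp_all add: mirror_def pressure_def inner_vec_def sum_2)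

text \<open>The energy flux pairs the pressure of one state with the normal velocity of the other.
  Mirroring keeps the pressure and flips the normal velocity, so the two products of the mirrored
  term cancel.\<close>

lemma mirror_flux_inner:
  assumes "norm n = 1"
  shows "((1 / 2) *\<^sub>R (normal_flux c n u + normal_flux c n (mirror n u))) \<bullet> u =
    1 / 2 * (normal_flux c n u \<bullet> u)"
proof -
  have nn: "n $ 1 * n $ 1 + n $ 2 * n $ 2 = 1"
    using assms by (simp add: norm_eq_1 inner_vec_def sum_2)
  define s where "s = u $ 2 * n $ 1 + u $ 3 * n $ 2"
  have "n $ 1 * (u $ 2 - 2 * s * n $ 1) + n $ 2 * (u $ 3 - 2 * s * n $ 2) = - s"
    unfolding s_def using nn by algebra
  then have "normal_flux c n (mirror n u) \<bullet> u = c * (u $ 1 * s + (- s) * u $ 1)"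
    unfolding normal_flux_inner mirror_nth s_def[symmetric] by (simp add: s_def mult.commute)
  also have "\<dots> = 0"
    by simp
  finally show ?thesis by (simp add: inner_add_left)
qed

lemma mirror_field_nth:
  "mirror_field T \<gamma> u x $ 1 = u x $ 1"
  "mirror_field T \<gamma> u x $ 2 = u x $ 2 -
     2 * face_normal T \<gamma> $ 1 * (face_normal T \<gamma> $ 1 * u (closest_point (affine hull \<gamma>) x) $ 2
       + face_normal T \<gamma> $ 2 * u (closest_point (affine hull \<gamma>) x) $ 3)"
  "mirror_field T \<gamma> u x $ 3 = u x $ 3 -
     2 * face_normal T \<gamma> $ 2 * (face_normal T \<gamma> $ 1 * u (closest_point (affine hull \<gamma>) x) $ 2
       + face_normal T \<gamma> $ 2 * u (closest_point (affine hull \<gamma>) x) $ 3)"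
  by (simp_all add: mirror_field_def Let_def pressure_def inner_vec_def sum_2 algebra_simps)

text \<open>The two distinct points make the affine hull of the face a genuine line;
  \<open>a\<close> is also the base point in the formula for the projection.\<close>

locale mirror_face =
  fixes T :: cut_mesh and \<gamma> :: "(real^2) set" and a b :: "real^2"
  assumes unit: "norm (face_normal T \<gamma>) = 1"
    and points: "a \<in> \<gamma>" "b \<in> \<gamma>" "a \<noteq> b"
    and orth: "y \<in> \<gamma> \<Longrightarrow> (y - a) \<bullet> face_normal T \<gamma> = 0"
begin

lemma closest_point:
  "closest_point (affine hull \<gamma>) x = x - ((x - a) \<bullet> face_normal T \<gamma>) *\<^sub>R face_normal T \<gamma>"
  using closest_point_line[OF unit points orth] .

lemma mirror_field_poly_fields:
  assumes "u \<in> poly_fields r"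
  shows "mirror_field T \<gamma> u \<in> poly_fields r"
proof -
  define n where "n = face_normal T \<gamma>"
  define g where "g = closest_point (affine hull \<gamma>)"
  have comp: "(\<lambda>x. u (g x) $ m) \<in> poly_scalar r" for m
  proof (rule poly_scalar_compose_affine)
    show "(\<lambda>x. u x $ m) \<in> poly_scalar r"
      using assms by (auto simp: poly_fields_def)
    show "g x $ 1 = ((a \<bullet> n) * n $ 1) + (1 - n $ 1 * n $ 1) * x $ 1 + (- n $ 2 * n $ 1) * x $ 2" for x
      by (simp add: g_def closest_point n_def inner_vec_def sum_2 algebra_simps)
    show "g x $ 2 = ((a \<bullet> n) * n $ 2) + (- n $ 1 * n $ 2) * x $ 1 + (1 - n $ 2 * n $ 2) * x $ 2" for x
      by (simp add: g_def closest_point n_def inner_vec_def sum_2 algebra_simps)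
  qed
  have "(\<lambda>x. u x $ m + (- 2 * n $ k) * (n $ 1 * u (g x) $ 2 + n $ 2 * u (g x) $ 3)) \<in> poly_scalar r"
    for m k
    using assms by (intro poly_scalar_add poly_scalar_scale comp) (auto simp: poly_fields_def)
  then show ?thesis
    using assms by (simp add: poly_fields_def forall_3 mirror_field_nth g_def n_def)
qed

text \<open>The projection is idempotent, so both mirrorings read the normal velocity at the same
  foot point. The second one finds it with the opposite sign and adds back what the first one
  subtracted.\<close>

lemma mirror_field_mirror_field: "mirror_field T \<gamma> (mirror_field T \<gamma> u) = u"
proof
  fix x
  define n where "n = face_normal T \<gamma>"
  define g where "g = closest_point (affine hull \<gamma>)"
  have nn: "n $ 1 * n $ 1 + n $ 2 * n $ 2 = 1"
    using unit by (simp add: n_def norm_eq_1 inner_vec_def sum_2)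
  have gg: "g (g x) = g x"
    unfolding g_def using points
    by (intro closest_point_self closest_point_in_set) (auto simp: closed_affine_hull)
  define s where "s = n $ 1 * u (g x) $ 2 + n $ 2 * u (g x) $ 3"
  have "n $ 1 * mirror_field T \<gamma> u (g x) $ 2 + n $ 2 * mirror_field T \<gamma> u (g x) $ 3 =
      s - 2 * (n $ 1 * n $ 1 + n $ 2 * n $ 2) * s"
    unfolding mirror_field_nth n_def[symmetric] g_def[symmetric] gg s_def[symmetric]
    by (simp add: s_def algebra_simps)
  then have flip: "n $ 1 * mirror_field T \<gamma> u (g x) $ 2 + n $ 2 * mirror_field T \<gamma> u (g x) $ 3 = - s"
    unfolding nn by simp
  show "mirror_field T \<gamma> (mirror_field T \<gamma> u) x = u x"
    unfolding vec_eq_iff forall_3 mirror_field_nth[of T \<gamma> "mirror_field T \<gamma> u"]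
      n_def[symmetric] g_def[symmetric] flip
    unfolding mirror_field_nth n_def[symmetric] g_def[symmetric] s_def[symmetric] by simp
qed

end

section \<open>One-dimensional Hausdorff measure\<close>

lemma sets_hausdorff1 [measurable_cong, simp]: "sets hausdorff1 = sets borel"
  unfolding hausdorff1_def
  by (metis sets.space_closed sets.sigma_sets_eq sets_measure_of space_borel)

lemma space_hausdorff1 [simp]: "space hausdorff1 = UNIV"
  unfolding hausdorff1_def by (simp add: space_measure_of_conv)

text \<open>Only an inequality, as \<open>measure_of\<close> yields the zero measure unless the outer measure is known
  to be countably additive on the Borel sets; upper bounds suffice here.\<close>

lemma emeasure_hausdorff1_le: "emeasure hausdorff1 S \<le> hausdorff1_outer S"
  unfolding hausdorff1_def by (simp add: emeasure_measure_of_conv)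

lemma emeasure_hausdorff1_singleton: "emeasure hausdorff1 {x} = 0"
proof -
  have "hausdorff1_outer {x} \<le> 0"
    unfolding hausdorff1_outer_def
  proof (intro SUP_least)
    fix \<delta> :: real assume "\<delta> \<in> {0<..}"
    then show "(INF A\<in>{A :: nat \<Rightarrow> 'a set. {x} \<subseteq> (\<Union>k. A k) \<and> (\<forall>k. bounded (A k) \<and> diameter (A k) \<le> \<delta>)}.
        \<Sum>k. ennreal (diameter (A k))) \<le> 0"
      by (intro INF_lower2[of "\<lambda>_. {x}"]) auto
  qed
  then show ?thesis
    using emeasure_hausdorff1_le[of "{x}"] by simp
qed

text \<open>The empty set and singletons have length zero. Faces have positive length, so this
  yields the two points that determine their line.\<close>

lemma hausdorff1_pos_two_points:
  assumes "emeasure hausdorff1 S > 0"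
  obtains x y where "x \<in> S" "y \<in> S" "x \<noteq> y"
proof -
  have "S \<noteq> {}" "\<And>x. S \<noteq> {x}"
    using assms emeasure_hausdorff1_singleton by (metis emeasure_empty less_irrefl)+
  then show ?thesis
    using that by blast
qed

text \<open>Cutting \<open>{0..R}\<close> into \<open>N\<close> equal pieces with
  \<open>R / N \<le> \<delta>\<close> gives an admissible cover of total diameter at most
  \<open>R\<close>, a bound that does not depend on \<open>\<delta>\<close>.\<close>

lemma hausdorff1_outer_segment_finite:
  fixes a d :: "'a::real_normed_vector"
  assumes "norm d = 1" "0 < R" "S \<subseteq> (\<lambda>t. a + t *\<^sub>R d) ` {0..R}"
  shows "hausdorff1_outer S \<le> ennreal R"
  unfolding hausdorff1_outer_def
proof (intro SUP_least)
  fix \<delta> :: real assume "\<delta> \<in> {0<..}"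
  then have \<delta>: "\<delta> > 0" by simp
  obtain N :: nat where N: "R / \<delta> < N" 
    using reals_Archimedean2 by blast
  then have "N > 0" 
    using \<delta> assms(2) by (metis divide_pos_pos gr0I less_asym of_nat_0)
  have RN: "R / N \<le> \<delta>"
    using N \<delta> \<open>N > 0\<close> by (simp add: field_simps)
  define f where "f t = a + t *\<^sub>R d" for t
  \<comment> \<open>Covers are infinite sequences, so the finite one is padded with empty sets of
    diameter zero.\<close>
  define A where "A k = (if k < N then f ` {R * k / N .. R * Suc k / N} else {})" for k
  have diam: "diameter (A k) \<le> (if k < N then R / N else 0)" and bdd: "bounded (A k)" for k
  proof -
    have "diameter (f ` {R * k / N .. R * Suc k / N}) \<le> R / N"
    proof (rule diameter_le)
      fix x y assume "x \<in> f ` {R * k / N .. R * Suc k / N}" "y \<in> f ` {R * k / N .. R * Suc k / N}"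
      then obtain s t where st: "x = f s" "y = f t" "s \<in> {R * k / N .. R * Suc k / N}"
        "t \<in> {R * k / N .. R * Suc k / N}" by blast
      have "x - y = (s - t) *\<^sub>R d" by (simp add: st f_def algebra_simps)
      then have "norm (x - y) = \<bar>s - t\<bar>" using assms(1) by simp
      also have "\<dots> \<le> R * Suc k / N - R * k / N" using st(3,4) by auto
      also have "\<dots> = R / N" by (simp add: algebra_simps add_divide_distrib)
      finally show "norm (x - y) \<le> R / N" .
    qed (use assms(2) in auto)
    then show "diameter (A k) \<le> (if k < N then R / N else 0)"
      by (simp add: A_def)
    have "compact (f ` {R * k / N .. R * Suc k / N})"
      unfolding f_def by (intro compact_continuous_image continuous_intros) auto
    then show "bounded (A k)" by (simp add: A_def compact_imp_bounded)
  qed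
  have cover: "S \<subseteq> (\<Union>k. A k)"
  proof
    fix x assume "x \<in> S"
    then obtain t where "t \<in> {0..R}" "x = a + t *\<^sub>R d" using assms(3) by blast
    then have t: "x = f t" "0 \<le> t" "t \<le> R" by (auto simp: f_def)
    \<comment> \<open>The minimum matters only at the right end: for \<open>t = R\<close> the floor
      is \<open>N\<close>, one past the last piece.\<close>
    define k where "k = min (nat \<lfloor>t * N / R\<rfloor>) (N - 1)"
    have "real k \<le> t * N / R" 
    proof -
      have "real k \<le> real (nat \<lfloor>t * N / R\<rfloor>)" by (simp add: k_def)
      also have "\<dots> \<le> t * N / R" using t assms(2) by (intro of_nat_floor) simp
      finally show ?thesis .
    qed
    moreover have "t * N / R \<le> real (Suc k)"
    proof (cases "nat \<lfloor>t * N / R\<rfloor> \<le> N - 1")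
      case True
      then have "k = nat \<lfloor>t * N / R\<rfloor>" by (simp add: k_def)
      then show ?thesis by linarith
    next
      case False
      then have "Suc k = N" using \<open>N > 0\<close> by (simp add: k_def)
      then show ?thesis using t assms(2) \<open>N > 0\<close> by (simp add: field_simps)
    qed
    moreover have "k < N" using \<open>N > 0\<close> by (simp add: k_def)
    ultimately have "x \<in> A k"
      using t assms(2) \<open>N > 0\<close> by (auto simp: A_def field_simps)
    then show "x \<in> (\<Union>k. A k)" by blast
  qed
  have "(\<Sum>k. ennreal (diameter (A k))) = (\<Sum>k<N. ennreal (diameter (A k)))"
    by (rule suminf_finite) (auto simp: A_def)
  also have "\<dots> \<le> (\<Sum>k<N. ennreal (R / N))"
    using diam by (intro sum_mono ennreal_leI) (metis lessThan_iff)
  also have "\<dots> = ennreal R"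
    using \<open>N > 0\<close> assms(2) by (simp add: ennreal_of_nat_eq_real_of_nat flip: ennreal_mult)
  finally have "(\<Sum>k. ennreal (diameter (A k))) \<le> ennreal R" .
  then show "(INF A\<in>{A :: nat \<Rightarrow> 'a set. S \<subseteq> (\<Union>k. A k) \<and> (\<forall>k. bounded (A k) \<and> diameter (A k) \<le> \<delta>)}.
      \<Sum>k. ennreal (diameter (A k))) \<le> ennreal R"
  proof (intro INF_lower2[of A])
    have "diameter (A k) \<le> \<delta>" for k
      using diam[of k] RN \<delta> by (auto split: if_splits)
    then show "A \<in> {A. S \<subseteq> (\<Union>k. A k) \<and> (\<forall>k. bounded (A k) \<and> diameter (A k) \<le> \<delta>)}"
      using cover bdd by blast
  qed
qed

text \<open>Turning \<open>n\<close> by a right angle gives the direction \<open>d\<close> of the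
  line. All points of the set lie within \<open>B\<close> of \<open>x0\<close>, so starting at
  \<open>x0 - B *\<^sub>R d\<close> the set is covered by a segment of length
  \<open>2 * B\<close>.\<close>

lemma hausdorff1_line_finite:
  fixes n :: "real^2"
  assumes "norm n = 1" "bounded S" "\<And>x y. x \<in> S \<Longrightarrow> y \<in> S \<Longrightarrow> (y - x) \<bullet> n = 0"
  shows "emeasure hausdorff1 S < \<infinity>"
proof (cases "S = {}")
  case False
  then obtain x0 where x0: "x0 \<in> S" by blast
  obtain e where e: "\<And>x. x \<in> S \<Longrightarrow> dist x0 x \<le> e"
    using assms(2) bounded_any_center by blast
  \<comment> \<open>The maximum with 1 keeps the radius positive even if the set is a single
    point.\<close>
  then obtain B where B: "B > 0" "\<And>x. x \<in> S \<Longrightarrow> dist x0 x \<le> B"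
    using e by (intro that[of "max e 1"]) (auto simp: le_max_iff_disj)
  define d :: "real^2" where "d = vector [- n $ 2, n $ 1]"
  have nn: "n $ 1 * n $ 1 + n $ 2 * n $ 2 = 1"
    using assms(1) by (simp add: norm_eq_1 inner_vec_def sum_2)
  then have d: "norm d = 1"
    by (simp add: norm_eq_1 inner_vec_def sum_2 d_def)
  have "S \<subseteq> (\<lambda>t. (x0 - B *\<^sub>R d) + t *\<^sub>R d) ` {0..2 * B}"
  proof
    fix x assume "x \<in> S"
    let ?t = "(x - x0) \<bullet> d"
    have "(x $ 1 - x0 $ 1) * n $ 1 + (x $ 2 - x0 $ 2) * n $ 2 = 0"
      using assms(3)[OF x0 \<open>x \<in> S\<close>] by (simp add: inner_vec_def sum_2)
    then have "x $ 1 - x0 $ 1 = ((x $ 1 - x0 $ 1) * - n $ 2 + (x $ 2 - x0 $ 2) * n $ 1) * - n $ 2"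
      "x $ 2 - x0 $ 2 = ((x $ 1 - x0 $ 1) * - n $ 2 + (x $ 2 - x0 $ 2) * n $ 1) * n $ 1"
      using nn by algebra+
    then have "x - x0 = ?t *\<^sub>R d"
      by (simp add: vec_eq_iff forall_2 inner_vec_def sum_2 d_def)
    moreover have "\<bar>?t\<bar> \<le> B"
      using Cauchy_Schwarz_ineq2[of "x - x0" d] B(2)[OF \<open>x \<in> S\<close>] d by (simp add: dist_norm norm_minus_commute)
    ultimately show "x \<in> (\<lambda>t. (x0 - B *\<^sub>R d) + t *\<^sub>R d) ` {0..2 * B}"
      by (intro image_eqI[of _ _ "?t + B"]) (auto simp: algebra_simps)
  qed
  then have "hausdorff1_outer S \<le> ennreal (2 * B)"
    using d B(1) by (intro hausdorff1_outer_segment_finite) auto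
  then show ?thesis
    using emeasure_hausdorff1_le[of S] by (metis ennreal_less_top infinity_ennreal_def order.strict_trans1)
qed simp

lemma set_integrable_compact_hausdorff1:
  fixes f :: "'a::metric_space \<Rightarrow> real"
  assumes "compact S" "emeasure hausdorff1 S < \<infinity>" "continuous_on S f"
  shows "set_integrable hausdorff1 S f"
proof -
  have S: "S \<in> sets borel" using assms(1) by (simp add: compact_imp_closed)
  obtain B where B: "\<And>x. x \<in> S \<Longrightarrow> norm (f x) \<le> B"
    using compact_imp_bounded[OF compact_continuous_image[OF assms(3,1)]] unfolding bounded_iff by blast
  have "(\<lambda>x. indicator S x *\<^sub>R f x) \<in> borel_measurable hausdorff1"
    using borel_measurable_continuous_on_indicator[OF S assms(3)]
    by (simp cong: measurable_cong_sets)
  then show ?thesis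
    unfolding set_integrable_def
    using S assms(2) B by (intro integrableI_bounded_set[where A = S and B = B]) (auto split: split_indicator)
qed

section \<open>Geometry of cut-cell meshes\<close>

lemma islimpt_closure_open:
  fixes S :: "'a::perfect_space set"
  assumes "open S" "x \<in> closure S"
  shows "x islimpt S"
  using assms interior_limit_point[of x S] unfolding closure_def by (metis Un_iff interior_open mem_Collect_eq)

text \<open>Points in the closure of an open set are limit points of it, so the filter
  \<open>at x within E\<close> is nontrivial and \<open>Lim\<close> picks the unique limit, which
  continuity of \<open>q\<close> identifies.\<close>

lemma trace_from_eq:
  assumes "open E" "x \<in> closure E" "continuous_on UNIV q" "\<And>y. y \<in> E \<Longrightarrow> w y = q y"
  shows "trace_from E w x = q x"
proof -
  have "(q \<longlongrightarrow> q x) (at x within E)"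
    using assms(3) by (metis UNIV_I continuous_on_def tendsto_within_subset subset_UNIV)
  moreover have "\<forall>\<^sub>F y in at x within E. w y = q y"
    using assms(4) by (simp add: eventually_at_filter)
  ultimately have "(w \<longlongrightarrow> q x) (at x within E)"
    using tendsto_cong by blast
  moreover have "\<not> trivial_limit (at x within E)"
    using islimpt_closure_open[OF assms(1,2)] by (simp add: trivial_limit_within)
  ultimately show ?thesis
    unfolding trace_from_def by (rule tendsto_Lim[rotated])
qed

text \<open>For \<open>i < j\<close> the earlier interval ends at
  \<open>g (Suc i) \<le> g j\<close>, so a common point is squeezed onto the node
  \<open>g j\<close>.\<close>

lemma grid_overlap:
  fixes g :: "nat \<Rightarrow> 'a::linorder"
  assumes "strict_mono_on {..N} g" "i < N" "j < N" "i \<noteq> j"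
    and "s \<in> {g i..g (Suc i)}" "s \<in> {g j..g (Suc j)}"
  shows "s = g (max i j)"
  using assms(2-)
proof (induction i j rule: linorder_wlog)
  case (le i j)
  then have "g (Suc i) \<le> g j"
    using strict_mono_on_leD[OF assms(1), of "Suc i" j] by auto
  with le show ?case by (auto simp: max_def)
next
  case (sym i j)
  then show ?case by (simp add: max.commute)
qed

text \<open>By \<open>grid_overlap\<close> and injectivity of the nodes the three pairwise maxima of
  the indices would agree. For distinct indices they do not: the pair without the largest index has
  a smaller maximum.\<close>

lemma grid_no_triple_overlap:
  fixes g :: "nat \<Rightarrow> 'a::linorder"
  assumes "strict_mono_on {..N} g" "i < N" "j < N" "k < N" "i \<noteq> j" "i \<noteq> k" "j \<noteq> k"
    and "s \<in> {g i..g (Suc i)}" "s \<in> {g j..g (Suc j)}" "s \<in> {g k..g (Suc k)}"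
  shows False
proof -
  have "g (max i j) = g (max i k)" "g (max i j) = g (max j k)"
    using grid_overlap[OF assms(1)] assms by metis+
  then have "max i j = max i k" "max i j = max j k"
    using strict_mono_on_imp_inj_on[OF assms(1)] assms(2-4) by (auto simp: inj_on_eq_iff)
  then show False
    using assms(5-7) by linarith
qed

locale cut_mesh_loc =
  fixes T :: cut_mesh
  assumes mesh: "cut_cell_mesh T"
begin

lemma xgrid_mono: "strict_mono_on {..nx T} (xgrid T)"
  and ygrid_mono: "strict_mono_on {..ny T} (ygrid T)"
  and open_Omega: "open (Omega T)"
  and bounded_Omega: "bounded (Omega T)"
  using mesh unfolding cut_cell_mesh_def by - (elim conjE, assumption)+

lemma interior_boundary_null:
  assumes "\<gamma> \<in> interior_faces T"
  shows "emeasure hausdorff1 (\<gamma> \<inter> frontier (Omega T)) = 0"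
proof -
  have "\<forall>\<gamma>\<in>interior_faces T. emeasure hausdorff1 (\<gamma> \<inter> frontier (Omega T)) = 0"
    using mesh unfolding cut_cell_mesh_def by (elim conjE)
  then show ?thesis using assms by (rule bspec)
qed

lemma interior_face:
  assumes "\<gamma> \<in> interior_faces T"
  shows "left_cell T \<gamma> \<in> cells T \<and> right_cell T \<gamma> \<in> cells T \<and> left_cell T \<gamma> \<noteq> right_cell T \<gamma> \<and>
    \<gamma> = closure (left_cell T \<gamma>) \<inter> closure (right_cell T \<gamma>) \<and>
    (\<forall>x\<in>\<gamma>. norm (normal T \<gamma> x) = 1 \<and>
       (\<forall>y\<in>\<gamma>. \<forall>z\<in>\<gamma>. (z - y) \<bullet> normal T \<gamma> x = 0) \<and>
       (\<forall>y\<in>left_cell T \<gamma>. \<forall>z\<in>right_cell T \<gamma>. (z - y) \<bullet> normal T \<gamma> x > 0))"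
proof -
  have "\<forall>\<gamma>\<in>interior_faces T.
    left_cell T \<gamma> \<in> cells T \<and> right_cell T \<gamma> \<in> cells T \<and> left_cell T \<gamma> \<noteq> right_cell T \<gamma> \<and>
    \<gamma> = closure (left_cell T \<gamma>) \<inter> closure (right_cell T \<gamma>) \<and>
    (\<forall>x\<in>\<gamma>. norm (normal T \<gamma> x) = 1 \<and>
       (\<forall>y\<in>\<gamma>. \<forall>z\<in>\<gamma>. (z - y) \<bullet> normal T \<gamma> x = 0) \<and>
       (\<forall>y\<in>left_cell T \<gamma>. \<forall>z\<in>right_cell T \<gamma>. (z - y) \<bullet> normal T \<gamma> x > 0))"
    using mesh unfolding cut_cell_mesh_def by (elim conjE)
  then show ?thesis using assms by (rule bspec)
qed

lemma interior_face_sides: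
  assumes "\<gamma> \<in> interior_faces T"
  shows "left_cell T \<gamma> \<in> cells T" "right_cell T \<gamma> \<in> cells T" "left_cell T \<gamma> \<noteq> right_cell T \<gamma>"
    "\<gamma> = closure (left_cell T \<gamma>) \<inter> closure (right_cell T \<gamma>)"
  using interior_face[OF assms] by - (elim conjE, assumption)+

lemma interior_face_normal:
  assumes "\<gamma> \<in> interior_faces T" "x \<in> \<gamma>"
  shows "norm (normal T \<gamma> x) = 1"
    "\<And>y z. y \<in> \<gamma> \<Longrightarrow> z \<in> \<gamma> \<Longrightarrow> (z - y) \<bullet> normal T \<gamma> x = 0"
    "\<And>y z. y \<in> left_cell T \<gamma> \<Longrightarrow> z \<in> right_cell T \<gamma> \<Longrightarrow> (z - y) \<bullet> normal T \<gamma> x > 0"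
proof -
  have "norm (normal T \<gamma> x) = 1 \<and>
       (\<forall>y\<in>\<gamma>. \<forall>z\<in>\<gamma>. (z - y) \<bullet> normal T \<gamma> x = 0) \<and>
       (\<forall>y\<in>left_cell T \<gamma>. \<forall>z\<in>right_cell T \<gamma>. (z - y) \<bullet> normal T \<gamma> x > 0)"
    using interior_face[OF assms(1)] assms(2) by (elim conjE bspec)
  then show "norm (normal T \<gamma> x) = 1"
    "\<And>y z. y \<in> \<gamma> \<Longrightarrow> z \<in> \<gamma> \<Longrightarrow> (z - y) \<bullet> normal T \<gamma> x = 0"
    "\<And>y z. y \<in> left_cell T \<gamma> \<Longrightarrow> z \<in> right_cell T \<gamma> \<Longrightarrow> (z - y) \<bullet> normal T \<gamma> x > 0"
    by simp_all
qed

lemma boundary_face_normal: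
  assumes "\<gamma> \<in> boundary_faces T"
  shows "AE x in hausdorff1. x \<in> \<gamma> \<longrightarrow> outer_normal (Omega T) x (normal T \<gamma> x)"
proof -
  have "\<forall>\<gamma>\<in>boundary_faces T. AE x in hausdorff1. x \<in> \<gamma> \<longrightarrow> outer_normal (Omega T) x (normal T \<gamma> x)"
    using mesh unfolding cut_cell_mesh_def by (elim conjE)
  then show ?thesis using assms by (rule bspec)
qed

lemma face_bij:
  assumes "E \<in> cells T"
  shows "bij_betw (face T E) (face_indices T E) (faces_of T E)"
proof -
  have "\<forall>E\<in>cells T. bij_betw (face T E) (face_indices T E) (faces_of T E) \<and>
      emeasure hausdorff1 (frontier E - \<Union>(faces_of T E)) = 0 \<and> divergence_theorem_on T E"
    using mesh unfolding cut_cell_mesh_def by (elim conjE)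
  from bspec[OF this assms] show ?thesis by (rule conjunct1)
qed

lemma cell_coords:
  assumes "C \<in> cells T"
  obtains i j where "i < nx T" "j < ny T"
    "C = box (vector [xgrid T i, ygrid T j]) (vector [xgrid T (Suc i), ygrid T (Suc j)]) \<inter> Omega T"
    "\<And>x. x \<in> closure C \<Longrightarrow> x $ 1 \<in> {xgrid T i..xgrid T (Suc i)} \<and> x $ 2 \<in> {ygrid T j..ygrid T (Suc j)}"
proof -
  obtain i j where ij: "i < nx T" "j < ny T"
    "C = box (vector [xgrid T i, ygrid T j]) (vector [xgrid T (Suc i), ygrid T (Suc j)]) \<inter> Omega T"
    using assms by (auto simp: cells_def background_cells_def)
  then have "closure C \<subseteq> cbox (vector [xgrid T i, ygrid T j]) (vector [xgrid T (Suc i), ygrid T (Suc j)])"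
    using box_subset_cbox by (intro closure_minimal) auto
  then have "x $ 1 \<in> {xgrid T i..xgrid T (Suc i)} \<and> x $ 2 \<in> {ygrid T j..ygrid T (Suc j)}"
    if "x \<in> closure C" for x
    using that by (fastforce simp: mem_box_cart forall_2)
  then show thesis
    using that ij by blast
qed

lemma cell_open:
  assumes "C \<in> cells T"
  shows "open C"
proof -
  obtain a b where "C = box a b \<inter> Omega T"
    using cell_coords[OF assms] by metis
  then show ?thesis
    using open_Omega open_box open_Int by blast
qed

lemma cell_nonempty: "C \<in> cells T \<Longrightarrow> C \<noteq> {}"
  by (auto simp: cells_def)

lemma cell_bounded: "C \<in> cells T \<Longrightarrow> bounded C"
  using bounded_Omega bounded_subset by (fastforce simp: cells_def)

text \<open>Two distinct common points differ in some coordinate. In that direction the three cells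
  must have the same grid index, since different intervals meet in at most one value. They then have
  three different indices in the other direction, which \<open>grid_no_triple_overlap\<close>
  excludes.\<close>

lemma three_cells_one_point:
  assumes "C1 \<in> cells T" "C2 \<in> cells T" "C3 \<in> cells T" "C1 \<noteq> C2" "C1 \<noteq> C3" "C2 \<noteq> C3"
    and "x \<in> closure C1 \<inter> closure C2 \<inter> closure C3" "y \<in> closure C1 \<inter> closure C2 \<inter> closure C3"
  shows "x = y"
proof (rule ccontr)
  assume "x \<noteq> y"
  obtain i1 j1 where 1: "i1 < nx T" "j1 < ny T"
    "C1 = box (vector [xgrid T i1, ygrid T j1]) (vector [xgrid T (Suc i1), ygrid T (Suc j1)]) \<inter> Omega T"
    "\<And>x. x \<in> closure C1 \<Longrightarrow> x $ 1 \<in> {xgrid T i1..xgrid T (Suc i1)} \<and> x $ 2 \<in> {ygrid T j1..ygrid T (Suc j1)}"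
    using cell_coords[OF assms(1)] by blast
  obtain i2 j2 where 2: "i2 < nx T" "j2 < ny T"
    "C2 = box (vector [xgrid T i2, ygrid T j2]) (vector [xgrid T (Suc i2), ygrid T (Suc j2)]) \<inter> Omega T"
    "\<And>x. x \<in> closure C2 \<Longrightarrow> x $ 1 \<in> {xgrid T i2..xgrid T (Suc i2)} \<and> x $ 2 \<in> {ygrid T j2..ygrid T (Suc j2)}"
    using cell_coords[OF assms(2)] by blast
  obtain i3 j3 where 3: "i3 < nx T" "j3 < ny T"
    "C3 = box (vector [xgrid T i3, ygrid T j3]) (vector [xgrid T (Suc i3), ygrid T (Suc j3)]) \<inter> Omega T"
    "\<And>x. x \<in> closure C3 \<Longrightarrow> x $ 1 \<in> {xgrid T i3..xgrid T (Suc i3)} \<and> x $ 2 \<in> {ygrid T j3..ygrid T (Suc j3)}"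
    using cell_coords[OF assms(3)] by blast
  have neq: "i1 \<noteq> i2 \<or> j1 \<noteq> j2" "i1 \<noteq> i3 \<or> j1 \<noteq> j3" "i2 \<noteq> i3 \<or> j2 \<noteq> j3"
    using assms(4-6) 1(3) 2(3) 3(3) by auto
  have in1: "x $ 1 \<in> {xgrid T i1..xgrid T (Suc i1)}" "y $ 1 \<in> {xgrid T i1..xgrid T (Suc i1)}"
    "x $ 2 \<in> {ygrid T j1..ygrid T (Suc j1)}" "y $ 2 \<in> {ygrid T j1..ygrid T (Suc j1)}"
    using 1(4) assms(7,8) by blast+
  have in2: "x $ 1 \<in> {xgrid T i2..xgrid T (Suc i2)}" "y $ 1 \<in> {xgrid T i2..xgrid T (Suc i2)}"
    "x $ 2 \<in> {ygrid T j2..ygrid T (Suc j2)}" "y $ 2 \<in> {ygrid T j2..ygrid T (Suc j2)}"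
    using 2(4) assms(7,8) by blast+
  have in3: "x $ 1 \<in> {xgrid T i3..xgrid T (Suc i3)}" "y $ 1 \<in> {xgrid T i3..xgrid T (Suc i3)}"
    "x $ 2 \<in> {ygrid T j3..ygrid T (Suc j3)}" "y $ 2 \<in> {ygrid T j3..ygrid T (Suc j3)}"
    using 3(4) assms(7,8) by blast+
  note gx = grid_overlap[OF xgrid_mono] and gy = grid_overlap[OF ygrid_mono]
  show False
  proof (cases "x $ 1 = y $ 1")
    case False
    then have "i1 = i2" "i1 = i3"
      using gx[OF 1(1) 2(1)] gx[OF 1(1) 3(1)] in1 in2 in3 by metis+
    then show False
      using grid_no_triple_overlap[OF ygrid_mono 1(2) 2(2) 3(2)] neq in1 in2 in3 by blast
  next
    case True
    then have "x $ 2 \<noteq> y $ 2"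
      using \<open>x \<noteq> y\<close> by (simp add: vec_eq_iff forall_2)
    then have "j1 = j2" "j1 = j3"
      using gy[OF 1(2) 2(2)] gy[OF 1(2) 3(2)] in1 in2 in3 by metis+
    then show False
      using grid_no_triple_overlap[OF xgrid_mono 1(1) 2(1) 3(1)] neq in1 in2 in3 by blast
  qed
qed

section \<open>Faces, their adjacent cells and their normals\<close>

lemma interior_face_pos: "\<gamma> \<in> interior_faces T \<Longrightarrow> emeasure hausdorff1 \<gamma> > 0"
  by (auto simp: interior_faces_def)

lemma boundary_face_pos: "\<gamma> \<in> boundary_faces T \<Longrightarrow> emeasure hausdorff1 \<gamma> > 0"
  by (auto simp: boundary_faces_def)

text \<open>A cell containing \<open>\<gamma>\<close> in its boundary is one of the two cells defining \<open>\<gamma>\<close>, since three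
  cells of the grid have at most one point in common.\<close>

lemma interior_face_adjacent:
  assumes "E \<in> cells T" "\<gamma> \<in> interior_faces_of T E"
  shows "left_cell T \<gamma> = E \<or> right_cell T \<gamma> = E"
proof (rule ccontr)
  assume *: "\<not> ?thesis"
  have \<gamma>: "\<gamma> \<in> interior_faces T" "\<gamma> \<subseteq> closure E"
    using assms(2) by (auto simp: interior_faces_of_def frontier_def)
  obtain x y where "x \<in> \<gamma>" "y \<in> \<gamma>" "x \<noteq> y"
    using hausdorff1_pos_two_points[OF interior_face_pos[OF \<gamma>(1)]] .
  moreover have "\<gamma> \<subseteq> closure (left_cell T \<gamma>) \<inter> closure (right_cell T \<gamma>) \<inter> closure E"
    using interior_face_sides(4)[OF \<gamma>(1)] \<gamma>(2) by blast
  ultimately show False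
    using three_cells_one_point[OF interior_face_sides(1,2)[OF \<gamma>(1)] assms(1)
        interior_face_sides(3)[OF \<gamma>(1)]] * by blast
qed

lemma neighbor_cell: "\<gamma> \<in> interior_faces T \<Longrightarrow> neighbor T E \<gamma> \<in> cells T"
  using interior_face_sides by (simp add: neighbor_def)

text \<open>A boundary face lies entirely in the frontier of the domain. As an interior face it
  would meet that frontier in a null set, contradicting its positive length.\<close>

lemma boundary_not_interior:
  assumes "\<gamma> \<in> boundary_faces T"
  shows "\<gamma> \<notin> interior_faces T"
proof
  assume "\<gamma> \<in> interior_faces T"
  moreover have "\<gamma> \<inter> frontier (Omega T) = \<gamma>"
    using assms by (auto simp: boundary_faces_def)
  ultimately show False
    using interior_boundary_null[of \<gamma>] boundary_face_pos[OF assms] by simp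
qed

text \<open>If \<open>\<gamma>\<close> came from another cell, it would lie in an interior face, whose intersection with the
  boundary of the domain is null.\<close>

lemma boundary_face_of_eq:
  assumes "E \<in> cells T" "\<gamma> \<in> boundary_faces_of T E"
  shows "\<gamma> = closure E \<inter> frontier (Omega T)"
proof (rule ccontr)
  assume *: "\<gamma> \<noteq> closure E \<inter> frontier (Omega T)"
  have \<gamma>: "\<gamma> \<in> boundary_faces T" "\<gamma> \<subseteq> closure E"
    using assms(2) by (auto simp: boundary_faces_of_def frontier_def)
  then obtain E' where E': "E' \<in> cells T" "\<gamma> = closure E' \<inter> frontier (Omega T)"
    by (auto simp: boundary_faces_def)
  let ?\<delta> = "closure E \<inter> closure E'"
  have "\<gamma> \<subseteq> ?\<delta> \<inter> frontier (Omega T)"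
    using \<gamma> E' by blast
  then have le: "emeasure hausdorff1 \<gamma> \<le> emeasure hausdorff1 (?\<delta> \<inter> frontier (Omega T))"
    "emeasure hausdorff1 \<gamma> \<le> emeasure hausdorff1 ?\<delta>"
    by (auto intro!: emeasure_mono borel_closed)
  then have "?\<delta> \<in> interior_faces T"
    using boundary_face_pos[OF \<gamma>(1)] assms(1) E' * unfolding interior_faces_def by fastforce
  then show False
    using interior_boundary_null le(1) boundary_face_pos[OF \<gamma>(1)] by fastforce
qed

lemma boundary_face_unique:
  "\<lbrakk>E \<in> cells T; \<gamma> \<in> boundary_faces_of T E; \<gamma>' \<in> boundary_faces_of T E\<rbrakk> \<Longrightarrow> \<gamma> = \<gamma>'"
  using boundary_face_of_eq[of E \<gamma>] boundary_face_of_eq[of E \<gamma>'] by simp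

text \<open>The vector provided by \<open>straight_face\<close> carries no length condition. Its
  norm comes from \<open>outer_normal\<close>, which holds almost everywhere and hence at some point
  of the face, as the face has positive length.\<close>

lemma boundary_face_unit_normal:
  assumes "\<gamma> \<in> boundary_faces T" "straight_face T \<gamma>"
  obtains n where "norm n = 1" "\<And>x. x \<in> \<gamma> \<Longrightarrow> normal T \<gamma> x = n"
    "\<And>x y. x \<in> \<gamma> \<Longrightarrow> y \<in> \<gamma> \<Longrightarrow> (y - x) \<bullet> n = 0"
proof -
  obtain n where n: "\<And>x. x \<in> \<gamma> \<Longrightarrow> normal T \<gamma> x = n"
    "\<And>x y. x \<in> \<gamma> \<Longrightarrow> y \<in> \<gamma> \<Longrightarrow> (y - x) \<bullet> n = 0"
    using assms(2) by (auto simp: straight_face_def)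
  have "\<exists>x\<in>\<gamma>. outer_normal (Omega T) x (normal T \<gamma> x)"
  proof (rule ccontr)
    assume "\<not> ?thesis"
    then have "AE x in hausdorff1. x \<notin> \<gamma>"
      using boundary_face_normal[OF assms(1)] by (auto elim: AE_mp)
    moreover have "\<gamma> \<in> sets hausdorff1"
      using assms(1) by (auto simp: boundary_faces_def intro!: borel_closed)
    ultimately have "emeasure hausdorff1 \<gamma> = 0"
      by (subst (asm) AE_iff_measurable[of \<gamma>]) auto
    then show False
      using boundary_face_pos[OF assms(1)] by simp
  qed
  then have "norm n = 1"
    using n(1) by (auto simp: outer_normal_def)
  then show thesis
    using that n by blast
qed

lemma mirror_face_boundary:
  assumes "\<gamma> \<in> boundary_faces T" "straight_face T \<gamma>"
  shows "\<exists>a b. mirror_face T \<gamma> a b"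
proof -
  obtain n where n: "norm n = 1" "\<And>x. x \<in> \<gamma> \<Longrightarrow> normal T \<gamma> x = n"
    "\<And>x y. x \<in> \<gamma> \<Longrightarrow> y \<in> \<gamma> \<Longrightarrow> (y - x) \<bullet> n = 0"
    using boundary_face_unit_normal[OF assms] by blast
  obtain a b where ab: "a \<in> \<gamma>" "b \<in> \<gamma>" "a \<noteq> b"
    using hausdorff1_pos_two_points[OF boundary_face_pos[OF assms(1)]] .
  have "face_normal T \<gamma> = n"
    unfolding face_normal_def using n(2) ab(1) by (intro the_equality) auto
  then show ?thesis
    using n(1,3) ab by (intro exI[of _ a] exI[of _ b]) (unfold_locales, auto)
qed

text \<open>The mesh conditions are stated for the normal at each point separately. All these unit
  normals are orthogonal to \<open>b - a\<close>, hence equal up to sign, and the direction from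
  left to right settles the sign.\<close>

lemma interior_face_normal_constant:
  assumes "\<gamma> \<in> interior_faces T"
  obtains n where "norm n = 1" "\<And>x. x \<in> \<gamma> \<Longrightarrow> normal T \<gamma> x = n"
    "\<And>x y. x \<in> \<gamma> \<Longrightarrow> y \<in> \<gamma> \<Longrightarrow> (y - x) \<bullet> n = 0"
proof -
  obtain a b where ab: "a \<in> \<gamma>" "b \<in> \<gamma>" "a \<noteq> b"
    using hausdorff1_pos_two_points[OF interior_face_pos[OF assms]] .
  note N = interior_face_normal[OF assms]
  obtain l where l: "l \<in> left_cell T \<gamma>" 
    using interior_face_sides(1)[OF assms] cell_nonempty by blast
  obtain q where q: "q \<in> right_cell T \<gamma>"
    using interior_face_sides(2)[OF assms] cell_nonempty by blast
  have "normal T \<gamma> x = normal T \<gamma> a" if "x \<in> \<gamma>" for x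
  proof -
    define m where "m = normal T \<gamma> a"
    define n where "n = normal T \<gamma> x"
    define d where "d = b - a"
    have "d \<noteq> 0" using ab by (simp add: d_def)
    have m: "m \<bullet> m = 1" "d \<bullet> m = 0" "(q - l) \<bullet> m > 0"
      using N[OF ab(1)] ab l q by (auto simp: m_def d_def norm_eq_1)
    have n: "n \<bullet> n = 1" "d \<bullet> n = 0" "(q - l) \<bullet> n > 0"
      using N[OF that] ab l q by (auto simp: n_def d_def norm_eq_1)
    have dd: "d$1 \<noteq> 0 \<or> d$2 \<noteq> 0"
      using \<open>d \<noteq> 0\<close> by (auto simp: vec_eq_iff forall_2)
    have 1: "m$1 * m$1 + m$2 * m$2 = 1" "d$1 * m$1 + d$2 * m$2 = 0"
      "n$1 * n$1 + n$2 * n$2 = 1" "d$1 * n$1 + d$2 * n$2 = 0"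
      using m(1,2) n(1,2) by (simp_all add: inner_vec_def sum_2)
    have "d$1 * (m$1 * n$2 - m$2 * n$1) = 0" "d$2 * (m$1 * n$2 - m$2 * n$1) = 0"
      using 1(2,4) by algebra+
    then have det: "m$1 * n$2 = m$2 * n$1"
      using dd by auto
    define s where "s = n \<bullet> m"
    have "n$1 = s * m$1" "n$2 = s * m$2"
      using det 1(1) unfolding s_def inner_vec_def sum_2 by (simp_all, algebra+)
    then have ns: "n = s *\<^sub>R m"
      by (simp add: vec_eq_iff forall_2)
    \<comment> \<open>Both normals have unit length and a positive product with the same vector
      \<open>q - l\<close> from the left to the right cell.\<close>
    then have "s * s = 1" "s > 0"
      using m n by (auto simp: zero_less_mult_iff)
    then have "s = 1"
      by (metis abs_of_pos power2_eq_square real_sqrt_abs real_sqrt_one)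
    then show ?thesis
      using ns by (simp add: m_def n_def)
  qed
  then show thesis
    using that[of "normal T \<gamma> a"] N(1,2)[OF ab(1)] by blast
qed

end

section \<open>Energy balance on a small cell\<close>

text \<open>An ordered pair of distinct indices is either increasing or the swap of an increasing
  one. This regroups a sum over pairs of faces into a sum face by face.\<close>

lemma sum_pairs_less:
  fixes g :: "nat \<Rightarrow> nat \<Rightarrow> 'a::comm_monoid_add"
  assumes "finite K"
  shows "(\<Sum>(i, j)\<in>{(i, j). i \<in> K \<and> j \<in> K \<and> i < j}. g i j + g j i) = (\<Sum>j\<in>K. \<Sum>i\<in>K - {j}. g i j)"
proof -
  let ?P = "{(i, j). i \<in> K \<and> j \<in> K \<and> i < j}"
  have fin: "finite ?P"
    by (rule finite_subset[of _ "K \<times> K"]) (use assms in auto)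
  have "(\<Sum>j\<in>K. \<Sum>i\<in>K - {j}. g i j) = (\<Sum>(j, i)\<in>(SIGMA j:K. K - {j}). g i j)"
    using assms by (simp add: sum.Sigma)
  also have "(SIGMA j:K. K - {j}) = ?P \<union> prod.swap ` ?P"
    by (auto simp: image_iff)
  also have "(\<Sum>(j, i)\<in>\<dots>. g i j) = (\<Sum>(j, i)\<in>?P. g i j) + (\<Sum>(j, i)\<in>prod.swap ` ?P. g i j)"
    using fin by (intro sum.union_disjoint) auto
  also have "(\<Sum>(j, i)\<in>prod.swap ` ?P. g i j) = (\<Sum>(i, j)\<in>?P. g i j)"
    by (subst sum.reindex) (auto simp: split_def)
  finally show ?thesis
    by (simp add: sum.distrib split_def add.commute)
qed

lemma ext_cell:
  assumes "u \<in> V_h T r" "C \<in> cells T"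
  shows "ext_cell r C u \<in> poly_fields r" "x \<in> C \<Longrightarrow> u x = ext_cell r C u x"
proof -
  have "\<exists>q. q \<in> poly_fields r \<and> (\<forall>x\<in>C. q x = u x)"
    using assms by (fastforce simp: V_h_def)
  from someI_ex[OF this]
  show "ext_cell r C u \<in> poly_fields r" "x \<in> C \<Longrightarrow> u x = ext_cell r C u x"
    by (auto simp: ext_cell_def)
qed

lemma (in cut_mesh_loc) trace_ext_cell:
  assumes "u \<in> V_h T r" "C \<in> cells T" "x \<in> closure C"
  shows "trace_from C u x = ext_cell r C u x"
proof (rule trace_from_eq[where q = "ext_cell r C u"])
  show "continuous_on UNIV (ext_cell r C u)"
    using ext_cell(1)[OF assms(1,2)] by (rule poly_fields_continuous)
  show "u y = ext_cell r C u y" if "y \<in> C" for y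
    using ext_cell(2)[OF assms(1,2) that] .
qed (use assms cell_open in auto)

section \<open>Face integrals of the energy flux\<close>

lemma normal_flux_continuous:
  assumes "w \<in> poly_fields r"
  shows "continuous_on S (\<lambda>x. normal_flux c n (w x) \<bullet> w x)"
proof -
  have "continuous_on S (\<lambda>x. w x $ m)" for m
    using assms poly_scalar_continuous by (auto simp: poly_fields_def)
  then show ?thesis
    unfolding normal_flux_inner by (intro continuous_on_add continuous_on_mult continuous_on_const)
qed

text \<open>The matrix \<open>normal_mat c n\<close> is symmetric, so the mixed terms in
  \<open>a\<close> and \<open>b\<close> cancel.\<close>

lemma jump_flux:
  "((1 / 2) *\<^sub>R (normal_flux c n a + normal_flux c n b)) \<bullet> (a - b) =
    1 / 2 * (normal_flux c n a \<bullet> a) - 1 / 2 * (normal_flux c n b \<bullet> b)"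
  by (simp add: normal_flux_inner inner_add_left algebra_simps)

text \<open>If \<open>E\<close> is the right cell, its outward normal is the negative of the face
  normal and the jump is neighbor minus \<open>E\<close>. The two sign changes cancel, so the result
  has the same form on either side.\<close>

lemma (in cut_mesh_loc) interior_face_term:
  assumes "E \<in> cells T" "\<gamma> \<in> interior_faces_of T E" "u \<in> V_h T r"
  shows "(LINT x:\<gamma>|hausdorff1.
           ((1 / 2) *\<^sub>R (normal_flux c (normal T \<gamma> x) (trace_from (left_cell T \<gamma>) u x) +
                        normal_flux c (normal T \<gamma> x) (trace_from (right_cell T \<gamma>) u x))) \<bullet>
           (trace_from (left_cell T \<gamma>) u x - trace_from (right_cell T \<gamma>) u x)) =
    1 / 2 * b_face T c E \<gamma> (ext_cell r E u) (ext_cell r E u) (ext_cell r E u) -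
    1 / 2 * b_face T c E \<gamma> (ext_cell r (neighbor T E \<gamma>) u) (ext_cell r (neighbor T E \<gamma>) u)
      (ext_cell r (neighbor T E \<gamma>) u)"
    (is "?lhs = _")
proof -
  have \<gamma>: "\<gamma> \<in> interior_faces T"
    using assms(2) by (simp add: interior_faces_of_def)
  note sides = interior_face_sides[OF \<gamma>]
  obtain n where n: "norm n = 1" "\<And>x. x \<in> \<gamma> \<Longrightarrow> normal T \<gamma> x = n"
    "\<And>x y. x \<in> \<gamma> \<Longrightarrow> y \<in> \<gamma> \<Longrightarrow> (y - x) \<bullet> n = 0"
    using interior_face_normal_constant[OF \<gamma>] by blast
  have "compact (closure (left_cell T \<gamma>) \<inter> closure (right_cell T \<gamma>))"
    using cell_bounded[OF sides(1)] by (intro compact_Int_closed) auto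
  then have cpt: "compact \<gamma>"
    using sides(4) by simp
  then have meas: "\<gamma> \<in> sets hausdorff1"
    by (simp add: compact_imp_closed borel_closed)
  have fin: "emeasure hausdorff1 \<gamma> < \<infinity>"
    using n(1) compact_imp_bounded[OF cpt] n(3) by (rule hausdorff1_line_finite)
  define L where "L = ext_cell r (left_cell T \<gamma>) u"
  define R where "R = ext_cell r (right_cell T \<gamma>) u"
  define g where "g w = (LINT x:\<gamma>|hausdorff1. normal_flux c n (w x) \<bullet> w x)" for w :: field
  have LR: "L \<in> poly_fields r" "R \<in> poly_fields r"
    using ext_cell(1)[OF assms(3)] sides by (auto simp: L_def R_def)
  have int: "set_integrable hausdorff1 \<gamma> (\<lambda>x. normal_flux c n (w x) \<bullet> w x)" if "w \<in> poly_fields r" for w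
    using set_integrable_compact_hausdorff1[OF cpt fin normal_flux_continuous[OF that]] .
  have tr: "trace_from (left_cell T \<gamma>) u x = L x" "trace_from (right_cell T \<gamma>) u x = R x"
    if "x \<in> \<gamma>" for x
  proof -
    have "x \<in> closure (left_cell T \<gamma>)" "x \<in> closure (right_cell T \<gamma>)"
      using that sides(4) by blast+
    then show "trace_from (left_cell T \<gamma>) u x = L x" "trace_from (right_cell T \<gamma>) u x = R x"
      unfolding L_def R_def using trace_ext_cell[OF assms(3)] sides(1,2) by auto
  qed
  have "?lhs = (LINT x:\<gamma>|hausdorff1. 1 / 2 * (normal_flux c n (L x) \<bullet> L x) - 1 / 2 * (normal_flux c n (R x) \<bullet> R x))"
    by (rule set_lebesgue_integral_cong[OF meas]) (intro allI impI, simp only: tr n(2) jump_flux)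
  also have "\<dots> = 1 / 2 * g L - 1 / 2 * g R"
    unfolding g_def set_integral_mult_right[symmetric]
    by (intro set_integral_diff(2) set_integrable_mult_right int LR)
  finally have lhs: "?lhs = 1 / 2 * g L - 1 / 2 * g R" .
  have flux_uminus: "normal_flux c (- n) v \<bullet> v = - (normal_flux c n v \<bullet> v)" for v
    by (simp add: normal_flux_inner algebra_simps)
  have b: "b_face T c E \<gamma> w w w = (if right_cell T \<gamma> = E then - g w else g w)" for w
  proof -
    have "b_face T c E \<gamma> w w w =
        (LINT x:\<gamma>|hausdorff1. (if right_cell T \<gamma> = E then -1 else 1) * (normal_flux c n (w x) \<bullet> w x))"
      unfolding b_face_def
      by (rule set_lebesgue_integral_cong[OF meas])
        (simp add: cell_normal_def \<gamma> n(2) flux_uminus inner_add_left)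
    then show ?thesis
      by (simp add: g_def)
  qed
  show ?thesis
  proof (cases "left_cell T \<gamma> = E")
    case True
    then have "right_cell T \<gamma> \<noteq> E" "neighbor T E \<gamma> = right_cell T \<gamma>"
      using sides(3) by (auto simp: neighbor_def)
    with True show ?thesis
      using lhs by (simp add: b L_def R_def)
  next
    case False
    then have "right_cell T \<gamma> = E" "neighbor T E \<gamma> = left_cell T \<gamma>"
      using interior_face_adjacent[OF assms(1,2)] by (auto simp: neighbor_def)
    then show ?thesis
      using lhs by (simp add: b L_def R_def)
  qed
qed

section \<open>Diagonal values of the stabilization terms on one small cell\<close>

locale small_cell_energy = cut_mesh_loc T for T +
  fixes c :: real and \<alpha> :: real and r :: nat and E :: "(real^2) set"
    and p :: "nat \<Rightarrow> nat \<Rightarrow> form" and pV pV' :: form and u :: field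
  assumes small: "small_cell_assumptions T \<alpha>"
    and E_small: "E \<in> small_cells T \<alpha>"
    and forms: "propagation_forms T c r E p pV pV'"
    and energy: "energy_preserving T c r E p"
    and reflects: "reflecting T r E p"
    and u: "u \<in> V_h T r"
begin

lemma E_cell: "E \<in> cells T"
  using E_small by (simp add: small_cells_def)

lemma face_mem: "i \<in> face_indices T E \<Longrightarrow> face T E i \<in> faces_of T E"
  using face_bij[OF E_cell] by (auto simp: bij_betw_def)

lemma straight: "\<gamma> \<in> boundary_faces_of T E \<Longrightarrow> straight_face T \<gamma>"
  using small E_small unfolding small_cell_assumptions_def by blast

text \<open>By \<open>mirror_flux_inner\<close> half of the unmirrored flux remains, while the
  average of two equal fluxes in \<open>b_face\<close> is the full flux. This accounts for the
  factor 1/2.\<close>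

lemma boundary_face_term:
  assumes "\<gamma> \<in> boundary_faces_of T E"
  shows "(LINT x:\<gamma>|hausdorff1.
           ((1 / 2) *\<^sub>R (normal_flux c (normal T \<gamma> x) (trace_from E u x) +
                        normal_flux c (normal T \<gamma> x) (mirror (normal T \<gamma> x) (trace_from E u x)))) \<bullet>
           trace_from E u x) =
    1 / 2 * b_face T c E \<gamma> (ext_cell r E u) (ext_cell r E u) (ext_cell r E u)"
proof -
  have \<gamma>: "\<gamma> \<in> boundary_faces T" and sub: "\<gamma> \<subseteq> closure E"
    using assms by (auto simp: boundary_faces_of_def frontier_def)
  obtain n where n: "norm n = 1" "\<And>x. x \<in> \<gamma> \<Longrightarrow> normal T \<gamma> x = n"
    "\<And>x y. x \<in> \<gamma> \<Longrightarrow> y \<in> \<gamma> \<Longrightarrow> (y - x) \<bullet> n = 0"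
    using boundary_face_unit_normal[OF \<gamma> straight[OF assms]] by blast
  have meas: "\<gamma> \<in> sets hausdorff1"
    using \<gamma> by (auto simp: boundary_faces_def intro!: borel_closed)
  have tr: "trace_from E u x = ext_cell r E u x" if "x \<in> \<gamma>" for x
    using trace_ext_cell[OF u E_cell subsetD[OF sub that]] .
  have cn: "cell_normal T E \<gamma> x = n" if "x \<in> \<gamma>" for x
    using boundary_not_interior[OF \<gamma>] n(2)[OF that] by (simp add: cell_normal_def)
  show ?thesis
    unfolding b_face_def set_integral_mult_right[symmetric]
    by (rule set_lebesgue_integral_cong[OF meas])
      (intro allI impI, simp only: tr n cn mirror_flux_inner[OF n(1)] scaleR_half_double)
qed

lemma face_boundary:
  assumes "i \<in> face_indices T E" "face T E i \<in> boundary_faces T"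
  shows "face T E i \<in> boundary_faces_of T E"
  using face_mem[OF assms(1)] assms(2)
  by (auto simp: faces_of_def interior_faces_of_def boundary_faces_of_def)

lemma face_interior:
  assumes "i \<in> face_indices T E" "face T E i \<notin> boundary_faces T"
  shows "face T E i \<in> interior_faces T"
  using face_mem[OF assms(1)] assms(2)
  by (auto simp: faces_of_def interior_faces_of_def boundary_faces_of_def)

text \<open>A cell has at most one boundary face and the numbering is injective. The ghost state of
  a pair is therefore always the mirror image of a state from a genuine neighbor.\<close>

lemma one_boundary_index:
  assumes "i \<in> face_indices T E" "j \<in> face_indices T E" "i \<noteq> j" "face T E i \<in> boundary_faces T"
  shows "face T E j \<notin> boundary_faces T"
proof
  assume "face T E j \<in> boundary_faces T"
  then have "face T E i = face T E j"
    using boundary_face_unique[OF E_cell] face_boundary assms by blast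
  then show False
    using face_bij[OF E_cell] assms(1-3) by (auto simp: bij_betw_def inj_on_eq_iff)
qed

abbreviation e :: field where "e \<equiv> ext_cell r E u"

abbreviation nb :: "nat \<Rightarrow> field" where "nb i \<equiv> ext_cell r (nbr_cell T E i) u"

abbreviation ep :: "nat \<Rightarrow> nat \<Rightarrow> field" where "ep i j \<equiv> ext_pair T r E i j u"

lemma e_poly: "e \<in> poly_fields r"
  using ext_cell(1)[OF u E_cell] .

lemma nb_poly:
  assumes "i \<in> face_indices T E" "face T E i \<notin> boundary_faces T"
  shows "nb i \<in> poly_fields r"
  unfolding nbr_cell_def
  by (rule ext_cell(1)[OF u neighbor_cell[OF face_interior[OF assms]]])

lemma mirror_face_index:
  assumes "i \<in> face_indices T E" "face T E i \<in> boundary_faces T"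
  shows "\<exists>a b. mirror_face T (face T E i) a b"
  using mirror_face_boundary[OF assms(2) straight[OF face_boundary[OF assms]]] .

lemma mirror_poly:
  assumes "i \<in> face_indices T E" "face T E i \<in> boundary_faces T" "w \<in> poly_fields r"
  shows "mirror_field T (face T E i) w \<in> poly_fields r"
  using mirror_face_index[OF assms(1,2)] mirror_face.mirror_field_poly_fields[OF _ assms(3)] by blast

lemma mirror_mirror:
  assumes "i \<in> face_indices T E" "face T E i \<in> boundary_faces T"
  shows "mirror_field T (face T E i) (mirror_field T (face T E i) w) = w"
  using mirror_face_index[OF assms] mirror_face.mirror_field_mirror_field by blast

lemma ep_poly:
  assumes "i \<in> face_indices T E" "j \<in> face_indices T E" "i \<noteq> j"
  shows "ep i j \<in> poly_fields r"
  using one_boundary_index[OF assms] mirror_poly[OF assms(1)] nb_poly assms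
  by (auto simp: ext_pair_def ext_mirror_def)

lemma p_form:
  "\<lbrakk>i \<in> face_indices T E; j \<in> face_indices T E; i \<noteq> j\<rbrakk> \<Longrightarrow> sym_lin_form r (p i j)"
  using forms[unfolded propagation_forms_def, THEN conjunct1] by blast

lemma p_sum:
  assumes "i \<in> face_indices T E" "j \<in> face_indices T E" "i \<noteq> j"
    and "u1 \<in> poly_fields r" "u2 \<in> poly_fields r" "w \<in> poly_fields r"
  shows "pV u1 u2 w + pV' u1 u2 w = p i j u1 u2 w + p j i u1 u2 w"
  using forms[unfolded propagation_forms_def, THEN conjunct2, THEN conjunct2, THEN conjunct2,
      rule_format, OF assms(4-6), THEN conjunct1, rule_format, OF assms(1-3)] by simp

lemma p_volume:
  assumes "i \<in> face_indices T E" "j \<in> face_indices T E" "i \<noteq> j" "w \<in> poly_fields r"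
  shows "2 / (real (num_faces T E) * (real (num_faces T E) - 1)) *
      (LINT x:E|lborel. flux_dot_grad c w w x) = 1 / 2 * p i j w w w + 1 / 2 * p j i w w w"
  using energy[unfolded energy_preserving_def, rule_format, OF assms(1-3), THEN conjunct1]
    assms(4) by (rule bspec)

lemma p_jump:
  assumes "i \<in> face_indices T E" "j \<in> face_indices T E" "i \<noteq> j"
    and "u1 \<in> poly_fields r" "u2 \<in> poly_fields r"
  shows "p i j u1 u2 u1 - p i j u1 u2 u2 = 1 / 2 * p i j u1 u1 u1 - 1 / 2 * p i j u2 u2 u2"
proof -
  have "p i j u1 u2 (\<lambda>x. u1 x - u2 x) = 1 / 2 * p i j u1 u1 u1 - 1 / 2 * p i j u2 u2 u2"
    using energy[unfolded energy_preserving_def, rule_format, OF assms(1-3), THEN conjunct2,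
        rule_format, OF assms(4,5)] .
  then show ?thesis
    using sym_lin_form_diff[OF p_form[OF assms(1-3)] assms(4,5,4,5)] by simp
qed

lemma p_reflect:
  assumes "i \<in> face_indices T E" "j \<in> face_indices T E" "i \<noteq> j" "face T E i \<in> boundary_faces T"
    and "u1 \<in> poly_fields r" "u2 \<in> poly_fields r" "w \<in> poly_fields r"
  shows "p j i u1 (mirror_field T (face T E i) u2) w =
    - p j i (mirror_field T (face T E i) u1) u2 (mirror_field T (face T E i) w)"
  using reflects[unfolded reflecting_def, rule_format,
      OF assms(1) face_boundary[OF assms(1,4)] assms(2) assms(3)[symmetric] assms(5-7)] .

text \<open>For \<open>w = u\<close> the forms \<open>pV\<close> and \<open>pV'\<close> receive the
  same arguments, so only their sum enters and \<open>p_sum\<close> splits it. The volume integrals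
  become cubic terms by \<open>p_volume\<close>; its factor 1/2 times the weights -1 and 1/2 gives
  the coefficients 1/2 and -1/4.\<close>

lemma J1_pair_eq:
  assumes "i \<in> face_indices T E" "j \<in> face_indices T E" "i \<noteq> j"
  shows "J1_pair T c r E pV pV' i j u u =
    1 / 2 * (p i j e e e + p j i e e e) - (p i j (ep i j) (ep j i) e + p j i (ep i j) (ep j i) e)
    + 1 / 2 * (p i j (ep i j) (ep j i) (ep i j) + p j i (ep i j) (ep j i) (ep i j))
    + 1 / 2 * (p i j (ep i j) (ep j i) (ep j i) + p j i (ep i j) (ep j i) (ep j i))
    - 1 / 4 * (p i j (ep i j) (ep i j) (ep i j) + p j i (ep i j) (ep i j) (ep i j))
    - 1 / 4 * (p i j (ep j i) (ep j i) (ep j i) + p j i (ep j i) (ep j i) (ep j i))"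
proof -
  have polys: "ep i j \<in> poly_fields r" "ep j i \<in> poly_fields r"
    using ep_poly assms by auto
  note s = p_sum[OF assms polys] and v = p_volume[OF assms]
  show ?thesis
    unfolding J1_pair_def list.map sum_list.Cons sum_list.Nil prod.case
      v[OF e_poly] v[OF polys(1)] v[OF polys(2)]
    using s[OF e_poly] s[OF polys(1)] s[OF polys(2)] by argo
qed

text \<open>\<open>J0_pair\<close> exchanges the indices when the boundary face comes second;
  symmetry in the first two arguments lets \<open>J1_pair\<close> follow.\<close>

lemma J1_pair_commute:
  assumes "i \<in> face_indices T E" "j \<in> face_indices T E" "i \<noteq> j"
  shows "J1_pair T c r E pV pV' j i u u = J1_pair T c r E pV pV' i j u u"
proof -
  have polys: "ep i j \<in> poly_fields r" "ep j i \<in> poly_fields r"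
    using ep_poly assms by auto
  note sym = sym_lin_form_commute[OF p_form[OF assms] polys]
    sym_lin_form_commute[OF p_form[OF assms(2,1) assms(3)[symmetric]] polys]
  show ?thesis
    unfolding J1_pair_eq[OF assms] J1_pair_eq[OF assms(2,1) assms(3)[symmetric]]
    using sym[OF e_poly] sym[OF polys(1)] sym[OF polys(2)] by argo
qed

text \<open>The second index is the face across which energy is exchanged, so that a sum over the
  first index has the shape of the face condition in \<open>propagation_forms\<close>.\<close>

definition net :: "nat \<Rightarrow> nat \<Rightarrow> real" where
  "net i j = 1 / 2 * p i j e e e - (if face T E j \<in> boundary_faces T then 0 else 1 / 2 * p i j (nb j) (nb j) (nb j))"

text \<open>The terms with mixed states tested against \<open>e\<close> cancel between the two
  parts. Of the remaining mixed terms one half stays, and \<open>p_jump\<close> turns it into cubic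
  terms with factor 1/4. Together with those from the volume integrals they either vanish or add up
  to the factor 1/2 in \<open>net\<close>.\<close>

lemma interior_pair:
  assumes "i \<in> face_indices T E" "j \<in> face_indices T E" "i \<noteq> j"
    and "face T E i \<notin> boundary_faces T" "face T E j \<notin> boundary_faces T"
  shows "J0_interior_pair T r E p i j u u + J1_pair T c r E pV pV' i j u u = net i j + net j i"
proof -
  have ep: "ep i j = nb i" "ep j i = nb j"
    using assms(4,5) by (auto simp: ext_pair_def)
  have poly: "nb i \<in> poly_fields r" "nb j \<in> poly_fields r"
    using nb_poly assms by auto
  note p_ji = p_form[OF assms(2,1) assms(3)[symmetric]]
  show ?thesis
    unfolding J1_pair_eq[OF assms(1-3)] J0_interior_pair_def Let_def ep net_def
      if_not_P[OF assms(4)] if_not_P[OF assms(5)]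
      sym_lin_form_diff[OF p_form[OF assms(1-3)] poly e_poly poly(2)]
      sym_lin_form_diff[OF p_ji poly e_poly poly(1)]
    using p_jump[OF assms(1-3) poly] p_jump[OF assms(2,1) assms(3)[symmetric] poly] by argo
qed

text \<open>The \<open>p i j\<close> terms are treated as for interior faces. For
  \<open>p j i\<close> two sums remain besides the term in \<open>e\<close>: the mixed state tested
  against the ghost state and against \<open>nb j\<close>, and the cubic terms of these two states.
  Reflection makes each sum zero.\<close>

lemma boundary_pair:
  assumes "i \<in> face_indices T E" "j \<in> face_indices T E" "i \<noteq> j" "face T E i \<in> boundary_faces T"
  shows "J0_boundary_pair T r E p i j u u + J1_pair T c r E pV pV' i j u u = net i j + net j i"
proof -
  let ?M = "mirror_field T (face T E i)"
  have j: "face T E j \<notin> boundary_faces T"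
    using one_boundary_index[OF assms] .
  have ep: "ep i j = ?M (nb j)" "ep j i = nb j"
    using assms(4) j by (auto simp: ext_pair_def ext_mirror_def)
  have poly: "?M (nb j) \<in> poly_fields r" "nb j \<in> poly_fields r"
    using nb_poly mirror_poly assms j by auto
  note MM = mirror_mirror[OF assms(1,4), of "nb j"]
  \<comment> \<open>Together with symmetry this says that testing the mixed state against the ghost
    state and against \<open>nb j\<close> gives opposite values.\<close>
  have "p j i (nb j) (?M (nb j)) (nb j) = - p j i (?M (nb j)) (nb j) (?M (nb j))"
    using p_reflect[OF assms poly(2,2,2)] .
  moreover have "p j i (nb j) (?M (nb j)) (nb j) = p j i (?M (nb j)) (nb j) (nb j)"
    using sym_lin_form_commute[OF p_form[OF assms(2,1) assms(3)[symmetric]] poly(2,1,2)] .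
  \<comment> \<open>Reflection is used again with the ghost state as second argument; mirroring it
    once more returns \<open>nb j\<close>, which leaves only cubic terms.\<close>
  moreover have "p j i (nb j) (nb j) (nb j) = - p j i (?M (nb j)) (?M (nb j)) (?M (nb j))"
    using p_reflect[OF assms poly(2,1,2)] unfolding MM .
  ultimately show ?thesis
    unfolding J1_pair_eq[OF assms(1-3)] J0_boundary_pair_def ext_mirror_def Let_def ep net_def
      if_P[OF assms(4)] if_not_P[OF j]
      sym_lin_form_diff[OF p_form[OF assms(1-3)] poly e_poly poly(2)]
    using p_jump[OF assms(1-3) poly] p_jump[OF assms(2,1) assms(3)[symmetric] poly] by argo
qed

lemma pair:
  assumes "i \<in> face_indices T E" "j \<in> face_indices T E" "i \<noteq> j"
  shows "J0_pair T r E p i j u u + J1_pair T c r E pV pV' i j u u = net i j + net j i"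
  unfolding J0_pair_def
  using interior_pair[OF assms] boundary_pair[OF assms]
    boundary_pair[OF assms(2,1) assms(3)[symmetric]] J1_pair_commute[OF assms]
  by auto

lemma net_sum:
  assumes "j \<in> face_indices T E"
  shows "(\<Sum>i\<in>face_indices T E - {j}. net i j) =
    1 / 2 * b_face T c E (face T E j) e e e -
    (if face T E j \<in> boundary_faces T then 0
     else 1 / 2 * b_face T c E (face T E j) (nb j) (nb j) (nb j))"
proof -
  have b: "(\<Sum>i\<in>face_indices T E - {j}. p i j w w w) = b_face T c E (face T E j) w w w"
    if "w \<in> poly_fields r" for w
    using forms[unfolded propagation_forms_def, THEN conjunct2, THEN conjunct2, THEN conjunct2,
        rule_format, OF that that that, THEN conjunct2, rule_format, OF assms] .
  show ?thesis
    using b[OF e_poly] b[OF nb_poly[OF assms]]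
    by (simp add: net_def sum_subtractf flip: sum_divide_distrib)
qed

lemma total: "J0 T c r \<Delta>t E p u u + J1 T c r \<Delta>t E pV pV' u u = 0"
proof -
  let ?K = "face_indices T E"
  let ?w = "\<lambda>\<gamma>. ext_cell r (neighbor T E \<gamma>) u"
  \<comment> \<open>One formula covers both kinds of faces, so that their sums merge into a sum over
    all faces of \<open>E\<close>.\<close>
  define F where "F \<gamma> = 1 / 2 * b_face T c E \<gamma> e e e -
      (if \<gamma> \<in> boundary_faces T then 0 else 1 / 2 * b_face T c E \<gamma> (?w \<gamma>) (?w \<gamma>) (?w \<gamma>))" for \<gamma>
  have fin: "finite (faces_of T E)"
    using bij_betw_finite[OF face_bij[OF E_cell]] by (simp add: face_indices_def)
  have F_int: "1 / 2 * b_face T c E \<gamma> e e e - 1 / 2 * b_face T c E \<gamma> (?w \<gamma>) (?w \<gamma>) (?w \<gamma>) = F \<gamma>"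
    if "\<gamma> \<in> interior_faces_of T E" for \<gamma>
    using boundary_not_interior that by (auto simp: F_def interior_faces_of_def)
  have F_bd: "1 / 2 * b_face T c E \<gamma> e e e = F \<gamma>" if "\<gamma> \<in> boundary_faces_of T E" for \<gamma>
    using that by (simp add: F_def boundary_faces_of_def)
  have J0: "J0 T c r \<Delta>t E p u u = eta T c r \<Delta>t E * (\<Sum>(i, j)\<in>index_pairs T E. J0_pair T r E p i j u u)
      - eta T c r \<Delta>t E * (\<Sum>\<gamma>\<in>interior_faces_of T E. F \<gamma>)
      - eta T c r \<Delta>t E * (\<Sum>\<gamma>\<in>boundary_faces_of T E. F \<gamma>)"
    unfolding J0_def
    by (intro arg_cong2[where f = "(-)"] arg_cong[where f = "(*) (eta T c r \<Delta>t E)"] sum.cong refl)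
      (simp_all only: interior_face_term[OF E_cell _ u] boundary_face_term F_int F_bd)
  have "(\<Sum>\<gamma>\<in>faces_of T E. F \<gamma>) =
      (\<Sum>\<gamma>\<in>interior_faces_of T E. F \<gamma>) + (\<Sum>\<gamma>\<in>boundary_faces_of T E. F \<gamma>)"
    using fin boundary_not_interior unfolding faces_of_def
    by (intro sum.union_disjoint) (auto simp: interior_faces_of_def boundary_faces_of_def)
  moreover have "(\<Sum>\<gamma>\<in>faces_of T E. F \<gamma>) = (\<Sum>j\<in>?K. F (face T E j))"
    using sum.reindex_bij_betw[OF face_bij[OF E_cell], of F] by simp
  \<comment> \<open>Through \<open>net_sum\<close> the face condition of the propagation forms
    enters, which links the face integrals to the pair terms.\<close>
  moreover have "\<dots> = (\<Sum>j\<in>?K. \<Sum>i\<in>?K - {j}. net i j)"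
    by (rule sum.cong) (simp_all add: net_sum F_def nbr_cell_def)
  moreover have "\<dots> = (\<Sum>(i, j)\<in>index_pairs T E. net i j + net j i)"
    unfolding index_pairs_def by (rule sum_pairs_less[symmetric]) (simp add: face_indices_def)
  moreover have "\<dots> = (\<Sum>(i, j)\<in>index_pairs T E.
      J0_pair T r E p i j u u + J1_pair T c r E pV pV' i j u u)"
    by (rule sum.cong) (auto simp: index_pairs_def pair)
  ultimately have sums: "(\<Sum>(i, j)\<in>index_pairs T E. J0_pair T r E p i j u u) +
      (\<Sum>(i, j)\<in>index_pairs T E. J1_pair T c r E pV pV' i j u u) =
      (\<Sum>\<gamma>\<in>interior_faces_of T E. F \<gamma>) + (\<Sum>\<gamma>\<in>boundary_faces_of T E. F \<gamma>)"
    by (simp add: sum.distrib split_def)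
  show ?thesis
    unfolding J0 J1_def
    using arg_cong[OF sums, of "\<lambda>s. eta T c r \<Delta>t E * s"] by (simp add: algebra_simps)
qed

end

theorem proposition2:
  fixes T :: cut_mesh and c \<alpha> \<Delta>t :: real and r :: nat and E :: "(real^2) set"
    and p :: "nat \<Rightarrow> nat \<Rightarrow> form" and pV pV' :: form
  assumes "c > 0" and "\<Delta>t > 0" and "0 < \<alpha>" and "\<alpha> < 1"
    and "cut_cell_mesh T"
    and "small_cell_assumptions T \<alpha>"
    and "E \<in> small_cells T \<alpha>"
    and "propagation_forms T c r E p pV pV'"
    and "energy_preserving T c r E p"
    and "reflecting T r E p"
  shows "\<forall>u\<in>V_h T r. J0 T c r \<Delta>t E p u u + J1 T c r \<Delta>t E pV pV' u u = 0"
proof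
  fix u assume "u \<in> V_h T r"
  then interpret small_cell_energy T c \<alpha> r E p pV pV' u
    using assms by unfold_locales
  show "J0 T c r \<Delta>t E p u u + J1 T c r \<Delta>t E pV pV' u u = 0"
    by (rule total)
qed

end
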